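(* Let $G$ be a topological group that is not locally compact, let $bG$ be a Hausdorff compactification of $G$, and let $Y = bG \setminus G$. Suppose that $Y$ has locally a point-countable $p$-metabase, and that the $\pi$-character of $Y$ is countable. Then $G$ and $bG$ are separable and metrizable.
   Context: All spaces (including topological groups) are assumed Hausdorff. A Hausdorff compactification $bG$ of $G$ is a compact Hausdorff space containing $G$ as a dense subspace. A space $X$ has locally a property $\Phi$ if for each $x \in X$ there is an open set $U$ with $x \in U$ such that the subspace $U$ has property $\Phi$. A collection $\mathcal{A}$ of subsets of a space $X$ is a $p$-metabase for $X$ if for any distinct points $x, y \in X$ there is a finite subcollection $\mathcal{F} \subset \mathcal{A}$ such that $x \in (\bigcup \mathcal{F})^{\circ} \subset \bigcup \mathcal{F} \subset X \setminus \{y\}$, where $^\circ$ denotes interior in $X$. A collection is point-countable if each point belongs to at most countably many of its members. A local $\pi$-base at $x$ in $X$ is a family $\mathcal{U}$ of non-empty open subsets of $X$ such that every open neighborhood of $x$ contains some member of $\mathcal{U}$; the $\pi$-character of $x$ in $X$ is $\pi\chi(x,X) = \min\{|\mathcal{U}| : \mathcal{U} \text{ is a local } \pi\text{-base at } x \text{ in } X\}$, and the $\pi$-character of $X$ is $\pi\chi(X) = \sup\{\pi\chi(x,X) : x \in X\}$. *)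

theory Defs
  imports "HOL-Analysis.Analysis" "HOL-Algebra.Group" "HOL-Library.Countable_Set_Type"
begin

unbundle cardinal_syntax

locale topological_group = group G for G (structure) +
  fixes T :: "'a topology"
  assumes topspace_eq_carrier: "topspace T = carrier G"
    and Hausdorff: "Hausdorff_space T"
    and continuous_mult: "continuous_map (prod_topology T T) T (\<lambda>(x, y). x \<otimes> y)"
    and continuous_inv: "continuous_map T T (\<lambda>x. inv x)"

text \<open>The compactification contains the space itself, not merely a homeomorphic copy of it.\<close>

definition Hausdorff_compactification :: "'a topology \<Rightarrow> 'a topology \<Rightarrow> bool" where
  "Hausdorff_compactification X B \<longleftrightarrow>
     compact_space B \<and> Hausdorff_space B \<and>
     topspace X \<subseteq> topspace B \<and> subtopology B (topspace X) = X \<and>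
     B closure_of topspace X = topspace B"

definition has_locally :: "('a topology \<Rightarrow> bool) \<Rightarrow> 'a topology \<Rightarrow> bool" where
  "has_locally \<Phi> X \<longleftrightarrow>
     (\<forall>x \<in> topspace X. \<exists>U. openin X U \<and> x \<in> U \<and> \<Phi> (subtopology X U))"

definition p_metabase :: "'a topology \<Rightarrow> 'a set set \<Rightarrow> bool" where
  "p_metabase X \<A> \<longleftrightarrow>
     \<A> \<subseteq> Pow (topspace X) \<and>
     (\<forall>x \<in> topspace X. \<forall>y \<in> topspace X. x \<noteq> y \<longrightarrow>
        (\<exists>\<F>. finite \<F> \<and> \<F> \<subseteq> \<A> \<and>
             x \<in> X interior_of \<Union>\<F> \<and> \<Union>\<F> \<subseteq> topspace X - {y}))"

definition point_countable :: "'a topology \<Rightarrow> 'a set set \<Rightarrow> bool" where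
  "point_countable X \<A> \<longleftrightarrow> (\<forall>x \<in> topspace X. countable {A \<in> \<A>. x \<in> A})"

definition has_point_countable_p_metabase :: "'a topology \<Rightarrow> bool" where
  "has_point_countable_p_metabase X \<longleftrightarrow> (\<exists>\<A>. p_metabase X \<A> \<and> point_countable X \<A>)"

definition local_pi_base :: "'a topology \<Rightarrow> 'a \<Rightarrow> 'a set set \<Rightarrow> bool" where
  "local_pi_base X x \<U> \<longleftrightarrow>
     (\<forall>U \<in> \<U>. openin X U \<and> U \<noteq> {}) \<and>
     (\<forall>V. openin X V \<and> x \<in> V \<longrightarrow> (\<exists>U \<in> \<U>. U \<subseteq> V))"

text \<open>
  Cardinals are represented by cardinal orders and compared up to order isomorphism, so a
  minimum of a set of cardinals is only determined up to \<open>=o\<close>. The supremum is the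
  least upper bound among the cardinals represented on the same type; since that type carries
  an upper bound, this is the supremum among all cardinals.
\<close>

definition card_Min :: "'a rel set \<Rightarrow> 'a rel" where
  "card_Min R = (SOME r. r \<in> R \<and> (\<forall>s \<in> R. r \<le>o s))"

definition card_Sup :: "'a rel set \<Rightarrow> 'a rel" where
  "card_Sup R = card_Min {k. Card_order k \<and> (\<forall>r \<in> R. r \<le>o k)}"

definition pi_character_at :: "'a topology \<Rightarrow> 'a \<Rightarrow> 'a set rel" where
  "pi_character_at X x = card_Min {|\<U>| |\<U>. local_pi_base X x \<U>}"

definition pi_character :: "'a topology \<Rightarrow> 'a set rel" where
  "pi_character X = card_Sup {pi_character_at X x |x. x \<in> topspace X}"

lemma card_Min:
  assumes "R \<noteq> {}" "\<And>r. r \<in> R \<Longrightarrow> Card_order r"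
  shows "card_Min R \<in> R" "\<And>s. s \<in> R \<Longrightarrow> card_Min R \<le>o s"
proof -
  have "\<exists>r. r \<in> R \<and> (\<forall>s \<in> R. r \<le>o s)"
    using exists_minim_Card_order[of R] assms by blast
  then have "card_Min R \<in> R \<and> (\<forall>s \<in> R. card_Min R \<le>o s)"
    unfolding card_Min_def by (rule someI_ex)
  then show "card_Min R \<in> R" "\<And>s. s \<in> R \<Longrightarrow> card_Min R \<le>o s" by auto
qed

lemma card_Sup:
  fixes R :: "'a rel set"
  assumes "\<And>r. r \<in> R \<Longrightarrow> Card_order r"
  shows "Card_order (card_Sup R)" "\<And>r. r \<in> R \<Longrightarrow> r \<le>o card_Sup R"
    "\<And>k :: 'b rel. Card_order k \<Longrightarrow> (\<And>r. r \<in> R \<Longrightarrow> r \<le>o k) \<Longrightarrow> card_Sup R \<le>o k"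
proof -
  let ?K = "{k :: 'a rel. Card_order k \<and> (\<forall>r \<in> R. r \<le>o k)}"
  have top: "r \<le>o |UNIV :: 'a set|" if "Card_order r" for r :: "'a rel"
    using that by (metis card_of_Field_ordIso card_of_mono1 subset_UNIV ordIso_ordLeq_trans ordIso_symmetric)
  then have ne: "?K \<noteq> {}" using assms card_of_Card_order by blast
  have mem: "card_Sup R \<in> ?K"
    unfolding card_Sup_def by (rule card_Min(1)[OF ne]) auto
  then show "Card_order (card_Sup R)" "\<And>r. r \<in> R \<Longrightarrow> r \<le>o card_Sup R" by auto
  fix k :: "'b rel" assume k: "Card_order k" "\<And>r. r \<in> R \<Longrightarrow> r \<le>o k"
  show "card_Sup R \<le>o k"
  proof (cases "k \<le>o |UNIV :: 'a set|")
    case True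
    then have "|Field k| \<le>o |UNIV :: 'a set|"
      using k(1) card_of_Field_ordIso ordIso_ordLeq_trans by blast
    then obtain f :: "'b \<Rightarrow> 'a" where f: "inj_on f (Field k)"
      by (metis card_of_ordLeq)
    then have iso: "|f ` Field k| =o k"
      using k(1) by (metis card_of_Field_ordIso card_of_ordIsoI inj_on_imp_bij_betw
        ordIso_symmetric ordIso_transitive)
    then have "|f ` Field k| \<in> ?K"
      using k(2) by (auto intro: ordLeq_ordIso_trans ordIso_symmetric card_of_Card_order)
    then have "card_Sup R \<le>o |f ` Field k|"
      unfolding card_Sup_def by (intro card_Min(2)[OF ne]) auto
    then show ?thesis using iso ordLeq_ordIso_trans by blast
  next
    case False
    then have "|UNIV :: 'a set| \<le>o k"
      using k(1) by (metis card_of_Well_order card_order_on_def ordLeq_total)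
    moreover have "card_Sup R \<le>o |UNIV :: 'a set|" using top mem by auto
    ultimately show ?thesis using ordLeq_transitive by blast
  qed
qed

lemma pi_character_at:
  shows "\<exists>\<U>. local_pi_base X x \<U> \<and> pi_character_at X x = |\<U>|"
    and "local_pi_base X x \<U> \<Longrightarrow> pi_character_at X x \<le>o |\<U>|"
proof -
  have "local_pi_base X x {U. openin X U \<and> U \<noteq> {}}"
    unfolding local_pi_base_def by blast
  then have ne: "{|\<U>| |\<U>. local_pi_base X x \<U>} \<noteq> {}" by blast
  show "\<exists>\<U>. local_pi_base X x \<U> \<and> pi_character_at X x = |\<U>|"
    using card_Min(1)[OF ne] card_of_Card_order unfolding pi_character_at_def by fastforce
  show "local_pi_base X x \<U> \<Longrightarrow> pi_character_at X x \<le>o |\<U>|"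
    unfolding pi_character_at_def by (rule card_Min(2)[OF ne]) (auto intro: card_of_Card_order)
qed

lemma pi_character_countable_iff:
  "pi_character X \<le>o natLeq \<longleftrightarrow>
     (\<forall>x \<in> topspace X. \<exists>\<U>. countable \<U> \<and> local_pi_base X x \<U>)"
proof -
  let ?R = "{pi_character_at X x |x. x \<in> topspace X}"
  have co: "\<And>r. r \<in> ?R \<Longrightarrow> Card_order r"
    using pi_character_at(1) card_of_Card_order by (smt (verit) mem_Collect_eq)
  have "pi_character X \<le>o natLeq \<longleftrightarrow> (\<forall>x \<in> topspace X. pi_character_at X x \<le>o natLeq)"
  proof
    assume "pi_character X \<le>o natLeq"
    then show "\<forall>x \<in> topspace X. pi_character_at X x \<le>o natLeq"
      using card_Sup(2)[OF co] ordLeq_transitive unfolding pi_character_def by blast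
  next
    assume "\<forall>x \<in> topspace X. pi_character_at X x \<le>o natLeq"
    then show "pi_character X \<le>o natLeq"
      unfolding pi_character_def
      by (intro card_Sup(3)[OF co]) (auto simp: natLeq_Card_order)
  qed
  also have "\<dots> \<longleftrightarrow> (\<forall>x \<in> topspace X. \<exists>\<U>. countable \<U> \<and> local_pi_base X x \<U>)"
    using pi_character_at countable_card_le_natLeq ordLeq_transitive by metis
  finally show ?thesis .
qed

end

theory Submission
  imports Defs
begin

text \<open>
  Let \<open>Y\<close> be the remainder. As \<open>G\<close> is homogeneous and not locally compact, \<open>Y\<close> is dense in \<open>bG\<close>. The argument
  rests on two facts about a space \<open>Z\<close> with a point-countable p-metabase. They hold when \<open>Z\<close> contains the closures in
  \<open>bG\<close> of its countable subsets, and more generally when it has a \<open>Sigma_family\<close>: such a \<open>Z\<close> is hereditarily separable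
  (\<open>hereditarily_separable_if_point_countable_p_metabase\<close>), and it has a countable p-metabase
  (\<open>countable_p_metabase_if_point_countable\<close>). Both are proved by closing off a countable set under
  witnesses for the finite families of members that meet it.
  
  If \<open>Y\<close> contained the closure of each of its countable subsets, then small closed pieces of \<open>Y\<close> would be separable
  and thus compact. So \<open>Y\<close> would be open in \<open>bG\<close>, and \<open>G\<close> would be compact
  (\<open>openin_if_closed_under_countable_closures\<close>). Hence some \<open>z \<in> G\<close> is in the closure of a countable set \<open>D \<subseteq> Y\<close>. Countable local
  \<pi>-bases at the points of \<open>D\<close> remain countable local \<pi>-bases in \<open>bG\<close>. Together they form one at \<open>z\<close>,
  which can be restricted to the dense set \<open>G\<close>. For a topological group this means that \<open>G\<close> is first countable.
  
  Next, countably many translates of any neighbourhood of \<open>\<one>\<close> cover \<open>G\<close>. Otherwise an uncountable discrete family of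
  translates in \<open>G\<close> yields an uncountable discrete set in \<open>Y\<close> whose closure is a compact subset of \<open>Y\<close>, which
  contradicts hereditary separability (\<open>countably_many_translates_cover\<close>). So \<open>G\<close> is second countable.
  
  A countable base of \<open>G\<close> provides a Sigma family for \<open>Y\<close>. Therefore \<open>Y\<close> is Lindelof, the local p-metabases combine to a
  point-countable one on \<open>Y\<close>, and this is refined to a countable one. From these countable data one obtains countably
  many closed sets of \<open>bG\<close> such that distinct points lie in disjoint members, whence \<open>bG\<close> is metrizable
  (\<open>metrizable_if_second_countable_dense_subspace\<close>).
\<close>

section \<open>General topology\<close>

text \<open>
  The finite intersection property and the finite subcover property combined: if an intersection of
  closed sets lies in a union of open sets, compactness of the cover formed by these open sets and the
  complements of the closed ones yields finitely many members of each family for which this is already true.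
\<close>

lemma compact_space_finite_intersection_cover:
  assumes "compact_space X" and "\<And>Q. Q \<in> \<Q> \<Longrightarrow> closedin X Q" and "\<And>V. V \<in> \<V> \<Longrightarrow> openin X V"
    and "topspace X \<inter> \<Inter>\<Q> \<subseteq> \<Union>\<V>"
  obtains \<S> \<W> where "finite \<S>" "\<S> \<subseteq> \<Q>" "finite \<W>" "\<W> \<subseteq> \<V>" "topspace X \<inter> \<Inter>\<S> \<subseteq> \<Union>\<W>"
proof -
  let ?c = "\<lambda>Q. topspace X - Q"
  have "\<forall>U \<in> \<V> \<union> ?c ` \<Q>. openin X U" using assms(2,3) by auto
  moreover have "topspace X \<subseteq> \<Union>(\<V> \<union> ?c ` \<Q>)" using assms(4) by blast
  ultimately obtain \<F> where F: "finite \<F>" "\<F> \<subseteq> \<V> \<union> ?c ` \<Q>" "topspace X \<subseteq> \<Union>\<F>"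
    using assms(1) unfolding compact_space_alt by meson
  have "finite (\<F> - \<V>)" "\<F> - \<V> \<subseteq> ?c ` \<Q>" using F by auto
  then obtain \<S> where S: "\<S> \<subseteq> \<Q>" "finite \<S>" "\<F> - \<V> = ?c ` \<S>"
    using finite_subset_image by metis
  have "topspace X \<inter> \<Inter>\<S> \<subseteq> \<Union>(\<F> \<inter> \<V>)"
  proof
    fix x assume x: "x \<in> topspace X \<inter> \<Inter>\<S>"
    then obtain V where V: "V \<in> \<F>" "x \<in> V" using F by auto
    then have "V \<notin> ?c ` \<S>" using x by auto
    then show "x \<in> \<Union>(\<F> \<inter> \<V>)" using V S by auto
  qed
  then show thesis using that[of \<S> "\<F> \<inter> \<V>"] S F by auto
qed

text \<open>
  Each finite subfamily \<open>\<E>\<close> of \<open>\<A>\<close> comes with a countable set \<open>\<Phi> \<E>\<close> of witnesses. Since \<open>\<A>\<close> is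
  point-countable on \<open>H\<close>, a countable set meets only countably many members of \<open>\<A>\<close>, so the witnesses of
  all finite families of such members can be added countably often. The resulting set contains
  the witnesses of every finite family of members that it meets. It plays the part that a countable
  elementary submodel would play.
\<close>

lemma countable_closing_off:
  assumes "\<And>x. x \<in> H \<Longrightarrow> countable {A \<in> \<A>. x \<in> A}"
    and "\<And>\<E>. finite \<E> \<Longrightarrow> \<E> \<subseteq> \<A> \<Longrightarrow> \<Phi> \<E> \<subseteq> H \<and> countable (\<Phi> \<E>)"
  shows "\<exists>C\<subseteq>H. countable C \<and> (\<forall>\<E>. finite \<E> \<longrightarrow> \<E> \<subseteq> {A \<in> \<A>. A \<inter> C \<noteq> {}} \<longrightarrow> \<Phi> \<E> \<subseteq> C)"
proof -
  define S where "S C = {A \<in> \<A>. A \<inter> C \<noteq> {}}" for C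
  define step where "step C = C \<union> \<Union>(\<Phi> ` {\<E>. finite \<E> \<and> \<E> \<subseteq> S C})" for C
  define c where "c n = (step ^^ n) {}" for n
  have c_Suc: "c (Suc n) = step (c n)" for n by (simp add: c_def)
  have S_eq: "S C = (\<Union>x\<in>C. {A \<in> \<A>. x \<in> A})" for C unfolding S_def by auto
  have c: "c n \<subseteq> H \<and> countable (c n)" for n
  proof (induction n)
    case 0 then show ?case by (simp add: c_def)
  next
    case (Suc n)
    have "countable (S (c n))" unfolding S_eq using Suc assms(1) by (intro countable_UN) auto
    then have "countable {\<E>. finite \<E> \<and> \<E> \<subseteq> S (c n)}" by (rule countable_Collect_finite_subset)
    moreover have "\<Phi> \<E> \<subseteq> H \<and> countable (\<Phi> \<E>)" if "finite \<E> \<and> \<E> \<subseteq> S (c n)" for \<E>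
      using assms(2)[of \<E>] that unfolding S_def by auto
    ultimately show ?case using Suc unfolding c_Suc step_def by (auto intro!: countable_Un countable_UN)
  qed
  have mono: "c m \<subseteq> c n" if "m \<le> n" for m n
    using that by (rule lift_Suc_mono_le[rotated]) (auto simp: c_Suc step_def)
  show ?thesis
  proof (intro exI[of _ "\<Union>n. c n"] conjI allI impI)
    show "(\<Union>n. c n) \<subseteq> H" "countable (\<Union>n. c n)" using c by auto
    fix \<E> assume fin: "finite \<E>" and E: "\<E> \<subseteq> {A \<in> \<A>. A \<inter> (\<Union>n. c n) \<noteq> {}}"
    then have "\<forall>A\<in>\<E>. \<exists>n. A \<in> S (c n)" unfolding S_def by blast
    then obtain f where f: "\<And>A. A \<in> \<E> \<Longrightarrow> A \<in> S (c (f A))" by metis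
    obtain n where n: "\<And>A. A \<in> \<E> \<Longrightarrow> f A \<le> n"
      using fin by (metis finite_imageI finite_nat_set_iff_bounded_le imageI)
    have "\<E> \<subseteq> S (c n)"
    proof
      fix A assume A: "A \<in> \<E>"
      show "A \<in> S (c n)" using f[OF A] mono[OF n[OF A]] unfolding S_def by auto
    qed
    then have "\<Phi> \<E> \<subseteq> c (Suc n)" unfolding c_Suc step_def using fin by auto
    then show "\<Phi> \<E> \<subseteq> (\<Union>n. c n)" by auto
  qed
qed

text \<open>
  Urysohn functions for the countably many disjoint pairs from \<open>\<N>\<close> separate points, hence embed the compact
  space into the metrizable space of real sequences.
\<close>

lemma compact_Hausdorff_metrizable_if_disjoint_closed_separation:
  assumes X: "compact_space X" "Hausdorff_space X" and "countable \<N>"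
    and cl: "\<And>N. N \<in> \<N> \<Longrightarrow> closedin X N"
    and sep: "\<And>x y. \<lbrakk>x \<in> topspace X; y \<in> topspace X; x \<noteq> y\<rbrakk> \<Longrightarrow>
                \<exists>N\<in>\<N>. \<exists>M\<in>\<N>. disjnt N M \<and> x \<in> N \<and> y \<in> M"
  shows "metrizable_space X"
proof -
  let ?P = "{(N, M) \<in> \<N> \<times> \<N>. disjnt N M}"
  have "normal_space X" using X compact_Hausdorff_or_regular_imp_normal_space by blast
  then have "\<forall>p\<in>?P. \<exists>f. continuous_map X euclideanreal f \<and> f ` fst p \<subseteq> {0} \<and> f ` snd p \<subseteq> {1}"
    using cl unfolding normal_space_iff_Urysohn_gen_alt[OF zero_neq_one] by auto
  from bchoice[OF this] obtain f where "\<forall>p\<in>?P. continuous_map X euclideanreal (f p) \<and>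
      f p ` fst p \<subseteq> {0} \<and> f p ` snd p \<subseteq> {1}" by blast
  then have f: "\<And>p. p \<in> ?P \<Longrightarrow> continuous_map X euclideanreal (f p)"
    "\<And>p. p \<in> ?P \<Longrightarrow> f p ` fst p \<subseteq> {0}" "\<And>p. p \<in> ?P \<Longrightarrow> f p ` snd p \<subseteq> {1}" by blast+
  have cP: "countable ?P" by (rule countable_subset[of _ "\<N> \<times> \<N>"]) (auto intro: assms(3))
  \<comment> \<open>The coordinates outside the range of the enumeration are given the constant value 0.\<close>
  define F :: "'a \<Rightarrow> nat \<Rightarrow> real"
    where "F x n = (if n \<in> to_nat_on ?P ` ?P then f (from_nat_into ?P n) x else 0)" for x n
  have F_pair: "F x (to_nat_on ?P p) = f p x" if "p \<in> ?P" for x p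
    unfolding F_def using that cP by simp
  have "continuous_map X euclideanreal (\<lambda>x. F x n)" for n
  proof (cases "n \<in> to_nat_on ?P ` ?P")
    case True
    then obtain p where "p \<in> ?P" "n = to_nat_on ?P p" by blast
    then show ?thesis using F_pair f(1) by simp
  qed (simp add: F_def)
  then have cont: "continuous_map X euclidean F"
    unfolding euclidean_product_topology[symmetric] by (simp add: continuous_map_componentwise_UNIV)
  have "inj_on F (topspace X)"
  proof (rule inj_onI, rule ccontr)
    fix x y assume xy: "x \<in> topspace X" "y \<in> topspace X" "F x = F y" "x \<noteq> y"
    obtain N M where NM: "N \<in> \<N>" "M \<in> \<N>" "disjnt N M" "x \<in> N" "y \<in> M"
      using sep[OF xy(1,2,4)] by blast
    define p where "p = (N, M)"
    have p: "p \<in> ?P" "x \<in> fst p" "y \<in> snd p" using NM by (auto simp: p_def)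
    have "f p x \<in> {0}" "f p y \<in> {1}"
      using subsetD[OF f(2)[OF p(1)] imageI[OF p(2)]] subsetD[OF f(3)[OF p(1)] imageI[OF p(3)]] by auto
    moreover have "f p x = f p y" using F_pair[OF p(1), of x] F_pair[OF p(1), of y] xy(3) by simp
    ultimately show False by simp
  qed
  then have "embedding_map X euclidean F"
    using continuous_imp_embedding_map cont X(1) Hausdorff_space_euclidean by metis
  then have "X homeomorphic_space subtopology euclidean (F ` topspace X)"
    by (rule embedding_map_imp_homeomorphic_space)
  moreover have "metrizable_space (subtopology euclidean (F ` topspace X))"
    by (intro metrizable_space_subtopology metrizable_space_euclidean)
  ultimately show ?thesis using homeomorphic_metrizable_space by metis
qed

lemma regular_space_closure_neighbourhood:
  assumes "regular_space X" "openin X V" "x \<in> V"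
  obtains U where "openin X U" "x \<in> U" "X closure_of U \<subseteq> V"
proof -
  have "closedin X (topspace X - V)" "x \<in> topspace X - (topspace X - V)"
    using assms(2,3) openin_subset by auto
  then obtain U where "openin X U" "x \<in> U" "disjnt (topspace X - V) (X closure_of U)"
    using assms(1) unfolding regular_space by blast
  then show thesis using that[of U] closure_of_subset_topspace[of X U] unfolding disjnt_def by blast
qed

section \<open>Point-countable p-metabases\<close>

lemma has_point_countable_p_metabase_subset:
  assumes "has_point_countable_p_metabase (subtopology X U)" and "Z \<subseteq> U"
  shows "has_point_countable_p_metabase (subtopology X Z)"
proof -
  let ?U = "subtopology X U" and ?Z = "subtopology X Z"
  obtain \<A> where A: "p_metabase ?U \<A>" "point_countable ?U \<A>"
    using assms(1) unfolding has_point_countable_p_metabase_def by blast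
  let ?A = "(\<lambda>A. A \<inter> Z) ` \<A>"
  have Z: "?Z = subtopology ?U Z" using assms(2) by (simp add: subtopology_subtopology Int_absorb1)
  have "p_metabase ?Z ?A"
    unfolding p_metabase_def
  proof (intro conjI ballI impI)
    show "?A \<subseteq> Pow (topspace ?Z)" using A(1) assms(2) unfolding p_metabase_def by auto
    fix x y assume xy: "x \<in> topspace ?Z" "y \<in> topspace ?Z" "x \<noteq> y"
    then have "x \<in> topspace ?U" "y \<in> topspace ?U" using assms(2) by auto
    then obtain \<F> where F: "finite \<F>" "\<F> \<subseteq> \<A>" "x \<in> ?U interior_of \<Union>\<F>" "\<Union>\<F> \<subseteq> topspace ?U - {y}"
      using A(1) xy(3) unfolding p_metabase_def by metis
    have "openin ?Z ((?U interior_of \<Union>\<F>) \<inter> Z)" unfolding Z by (simp add: openin_subtopology_Int)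
    moreover have "(?U interior_of \<Union>\<F>) \<inter> Z \<subseteq> \<Union>((\<lambda>A. A \<inter> Z) ` \<F>)"
      using interior_of_subset[of ?U "\<Union>\<F>"] by auto
    ultimately have "(?U interior_of \<Union>\<F>) \<inter> Z \<subseteq> ?Z interior_of \<Union>((\<lambda>A. A \<inter> Z) ` \<F>)"
      by (intro interior_of_maximal)
    then have "x \<in> ?Z interior_of \<Union>((\<lambda>A. A \<inter> Z) ` \<F>)" using F(3) xy(1) by auto
    then show "\<exists>\<F>. finite \<F> \<and> \<F> \<subseteq> ?A \<and> x \<in> ?Z interior_of \<Union>\<F> \<and> \<Union>\<F> \<subseteq> topspace ?Z - {y}"
      using F(1,2,4) by (intro exI[of _ "(\<lambda>A. A \<inter> Z) ` \<F>"]) auto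
  qed
  moreover have "point_countable ?Z ?A"
    unfolding point_countable_def
  proof
    fix x assume x: "x \<in> topspace ?Z"
    have "{A \<in> ?A. x \<in> A} \<subseteq> (\<lambda>A. A \<inter> Z) ` {A \<in> \<A>. x \<in> A}" by auto
    moreover have "countable {A \<in> \<A>. x \<in> A}"
      using A(2) x assms(2) unfolding point_countable_def by auto
    ultimately show "countable {A \<in> ?A. x \<in> A}" by (rule countable_subset[OF _ countable_image])
  qed
  ultimately show ?thesis unfolding has_point_countable_p_metabase_def by blast
qed

text \<open>
  Local p-metabases on the members of a countable open cover \<open>\<U>\<close> can be united. The members of \<open>\<U>\<close>
  themselves are added to separate a point of such a member from a point outside it.
\<close>

lemma Lindelof_has_point_countable_p_metabase_if_locally:
  assumes "Lindelof_space X" and "has_locally has_point_countable_p_metabase X"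
  shows "has_point_countable_p_metabase X"
proof -
  let ?good = "\<lambda>U. openin X U \<and> has_point_countable_p_metabase (subtopology X U)"
  have "\<Union>{U. ?good U} = topspace X"
    using assms(2) openin_subset unfolding has_locally_def by fastforce
  then obtain \<U> where U: "countable \<U>" "\<U> \<subseteq> {U. ?good U}" "\<Union>\<U> = topspace X"
    using Lindelof_spaceD[OF assms(1), of "{U. ?good U}"] by auto
  then have "\<forall>U\<in>\<U>. \<exists>\<A>. p_metabase (subtopology X U) \<A> \<and> point_countable (subtopology X U) \<A>"
    unfolding has_point_countable_p_metabase_def by blast
  then obtain \<A> where A: "\<And>U. U \<in> \<U> \<Longrightarrow> p_metabase (subtopology X U) (\<A> U)"
    "\<And>U. U \<in> \<U> \<Longrightarrow> point_countable (subtopology X U) (\<A> U)" by metis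
  let ?A = "\<U> \<union> (\<Union>U\<in>\<U>. \<A> U)"
  have opU: "openin X U" if "U \<in> \<U>" for U using U that by auto
  have tU: "topspace (subtopology X U) = U" if "U \<in> \<U>" for U
    using opU[OF that] openin_subset by fastforce
  have subA: "A \<subseteq> U" if "U \<in> \<U>" "A \<in> \<A> U" for U A
    using A(1)[OF that(1)] that tU unfolding p_metabase_def by blast
  have "p_metabase X ?A"
    unfolding p_metabase_def
  proof (intro conjI ballI impI)
    show "?A \<subseteq> Pow (topspace X)" using subA U(3) by blast
    fix x y assume xy: "x \<in> topspace X" "y \<in> topspace X" "x \<noteq> y"
    obtain W where W: "W \<in> \<U>" "x \<in> W" using U(3) xy(1) by blast
    show "\<exists>\<F>. finite \<F> \<and> \<F> \<subseteq> ?A \<and> x \<in> X interior_of \<Union>\<F> \<and> \<Union>\<F> \<subseteq> topspace X - {y}"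
    proof (cases "y \<in> W")
      case True
      then obtain \<F> where F: "finite \<F>" "\<F> \<subseteq> \<A> W"
        "x \<in> subtopology X W interior_of \<Union>\<F>" "\<Union>\<F> \<subseteq> W - {y}"
        using A(1)[OF W(1)] W xy(3) tU[OF W(1)] unfolding p_metabase_def by metis
      have "x \<in> X interior_of \<Union>\<F>"
        using F(3) interior_of_subtopology_open[OF opU[OF W(1)]] by auto
      then show ?thesis using F W U(3) by (intro exI[of _ \<F>]) blast
    next
      case False
      then show ?thesis using W U(3) opU interior_of_openin by (intro exI[of _ "{W}"]) fastforce
    qed
  qed
  moreover have "point_countable X ?A"
    unfolding point_countable_def
  proof
    fix x assume "x \<in> topspace X"
    have "{A \<in> ?A. x \<in> A} \<subseteq> \<U> \<union> (\<Union>U\<in>\<U>. {A \<in> \<A> U. x \<in> A})" by blast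
    moreover have "countable {A \<in> \<A> U. x \<in> A}" if "U \<in> \<U>" for U
    proof (cases "x \<in> U")
      case True then show ?thesis using A(2)[OF that] tU[OF that] unfolding point_countable_def by auto
    next
      case False
      then have "{A \<in> \<A> U. x \<in> A} = {}" using subA[OF that] by blast
      then show ?thesis by (metis countable_empty)
    qed
    then have "countable (\<U> \<union> (\<Union>U\<in>\<U>. {A \<in> \<A> U. x \<in> A}))" using U(1) by blast
    ultimately show "countable {A \<in> ?A. x \<in> A}" using countable_subset by blast
  qed
  ultimately show ?thesis unfolding has_point_countable_p_metabase_def by blast
qed

lemma has_locally_point_countable_p_metabase_subset:
  assumes loc: "has_locally has_point_countable_p_metabase (subtopology X S)" and "Z \<subseteq> S"
  shows "has_locally has_point_countable_p_metabase (subtopology X Z)"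
  unfolding has_locally_def
proof
  fix x assume x: "x \<in> topspace (subtopology X Z)"
  then obtain U where U: "openin (subtopology X S) U" "x \<in> U"
    "has_point_countable_p_metabase (subtopology (subtopology X S) U)"
    using loc \<open>Z \<subseteq> S\<close> unfolding has_locally_def by auto
  have "subtopology (subtopology X S) U = subtopology X U"
    using openin_subset[OF U(1)] by (simp add: subtopology_subtopology Int_absorb1)
  then have "has_point_countable_p_metabase (subtopology X (U \<inter> Z))"
    using has_point_countable_p_metabase_subset[of X U "U \<inter> Z"] U(3) by simp
  moreover have "subtopology (subtopology X Z) (U \<inter> Z) = subtopology X (U \<inter> Z)"
    by (simp add: subtopology_subtopology Int_absorb1)
  moreover have "openin (subtopology X Z) (U \<inter> Z)"
  proof -
    obtain W where "openin X W" "U = W \<inter> S" using U(1) unfolding openin_subtopology by blast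
    moreover from this have "U \<inter> Z = W \<inter> Z" using \<open>Z \<subseteq> S\<close> by blast
    ultimately show ?thesis by (simp add: openin_subtopology_Int)
  qed
  ultimately show "\<exists>U. openin (subtopology X Z) U \<and> x \<in> U \<and>
      has_point_countable_p_metabase (subtopology (subtopology X Z) U)"
    using x U(2) by (intro exI[of _ "U \<inter> Z"]) auto
qed

section \<open>Sigma families\<close>

text \<open>
  A countable closed family with this property makes \<open>Z\<close> behave like a Lindelof Sigma-space in the sense of Nagami:
  every \<open>y\<close> lies in the set \<open>K = \<Inter>{Q \<in> \<Q>. y \<in> Q}\<close>, and when \<open>X\<close> is compact, the finite intersections
  of members of \<open>\<Q>\<close> around \<open>y\<close> shrink to the compact set \<open>topspace X \<inter> K\<close>. Only the parts of \<open>K\<close> in closures of countable subsets of \<open>Z\<close>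
  have to stay inside \<open>Z\<close>. In this form the notion also covers, with the empty family, the
  spaces whose countable subsets have compact closures; such a space need not be Lindelof a priori.
\<close>

definition Sigma_family :: "'a topology \<Rightarrow> 'a set \<Rightarrow> 'a set set \<Rightarrow> bool" where
  "Sigma_family X Z \<Q> \<longleftrightarrow>
     countable \<Q> \<and> (\<forall>Q\<in>\<Q>. closedin X Q) \<and> Z \<subseteq> topspace X \<and>
     (\<forall>y\<in>Z. \<forall>C\<subseteq>Z. countable C \<longrightarrow> X closure_of C \<inter> \<Inter>{Q \<in> \<Q>. y \<in> Q} \<subseteq> Z)"

lemma Sigma_familyI:
  assumes "countable \<Q>" "\<And>Q. Q \<in> \<Q> \<Longrightarrow> closedin X Q" "Z \<subseteq> topspace X"
    and "\<And>y. y \<in> Z \<Longrightarrow> topspace X \<inter> \<Inter>{Q \<in> \<Q>. y \<in> Q} \<subseteq> Z"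
  shows "Sigma_family X Z \<Q>"
  unfolding Sigma_family_def
proof (intro conjI ballI allI impI)
  fix y C assume "y \<in> Z"
  show "X closure_of C \<inter> \<Inter>{Q \<in> \<Q>. y \<in> Q} \<subseteq> Z"
    using assms(4)[OF \<open>y \<in> Z\<close>] closure_of_subset_topspace[of X C] by blast
qed (use assms in auto)

lemma Sigma_family_empty:
  assumes "Z \<subseteq> topspace X" "\<And>C. C \<subseteq> Z \<Longrightarrow> countable C \<Longrightarrow> X closure_of C \<subseteq> Z"
  shows "Sigma_family X Z {}"
  using assms unfolding Sigma_family_def by auto

text \<open>
  The sets \<open>topspace X \<inter> \<Inter>{Q \<in> \<Q>. y \<in> Q}\<close> are compact subsets of \<open>Z\<close>. A finite subcover of one of them
  covers a finite intersection of members of \<open>\<Q>\<close>, and there are only countably many such intersections.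
\<close>

lemma Lindelof_space_if_countable_closed_family:
  assumes X: "compact_space X" and Q: "countable \<Q>" "\<And>Q. Q \<in> \<Q> \<Longrightarrow> closedin X Q"
    and Z: "Z \<subseteq> topspace X" and QZ: "\<And>y. y \<in> Z \<Longrightarrow> topspace X \<inter> \<Inter>{Q \<in> \<Q>. y \<in> Q} \<subseteq> Z"
  shows "Lindelof_space (subtopology X Z)"
  unfolding Lindelof_space_def
proof (intro allI impI)
  fix \<U> assume U: "(\<forall>U\<in>\<U>. openin (subtopology X Z) U) \<and> \<Union>\<U> = topspace (subtopology X Z)"
  define \<O> where "\<O> = {W. openin X W \<and> W \<inter> Z \<in> \<U>}"
  have cover: "Z \<subseteq> \<Union>\<O>"
  proof
    fix y assume y: "y \<in> Z"
    have "y \<in> \<Union>\<U>" using y U Z by auto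
    then obtain U0 where U0: "U0 \<in> \<U>" "y \<in> U0" by blast
    then obtain W where W: "openin X W" "U0 = W \<inter> Z" using U unfolding openin_subtopology by blast
    then have "W \<in> \<O>" using U0(1) unfolding \<O>_def by simp
    moreover have "y \<in> W" using W(2) U0(2) by simp
    ultimately show "y \<in> \<Union>\<O>" by (rule UnionI)
  qed
  define P where "P \<S> \<F> \<longleftrightarrow> finite \<F> \<and> \<F> \<subseteq> \<O> \<and> topspace X \<inter> \<Inter>\<S> \<subseteq> \<Union>\<F>" for \<S> \<F>
  define f where "f \<S> = (SOME \<F>. P \<S> \<F>)" for \<S>
  define \<SS> where "\<SS> = {\<S>. (finite \<S> \<and> \<S> \<subseteq> \<Q>) \<and> (\<exists>\<F>. P \<S> \<F>)}"
  have f: "P \<S> (f \<S>)" if "\<S> \<in> \<SS>" for \<S>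
    using that unfolding f_def \<SS>_def by (auto intro: someI_ex)
  define \<V> where "\<V> = (\<lambda>W. W \<inter> Z) ` (\<Union>\<S>\<in>\<SS>. f \<S>)"
  have "countable {\<S>. finite \<S> \<and> \<S> \<subseteq> \<Q>}" using Q(1) by (rule countable_Collect_finite_subset)
  then have "countable \<SS>" by (rule countable_subset[rotated]) (auto simp: \<SS>_def)
  moreover have "countable (f \<S>)" if "\<S> \<in> \<SS>" for \<S>
    using f[OF that] unfolding P_def by (simp add: countable_finite)
  ultimately have "countable \<V>" unfolding \<V>_def by (intro countable_image countable_UN)
  moreover have VU: "\<V> \<subseteq> \<U>"
  proof
    fix V assume "V \<in> \<V>"
    then obtain \<S> W where SW: "\<S> \<in> \<SS>" "W \<in> f \<S>" "V = W \<inter> Z" unfolding \<V>_def by blast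
    then have "W \<in> \<O>" using f[OF SW(1)] unfolding P_def by blast
    then show "V \<in> \<U>" unfolding \<O>_def SW(3) by simp
  qed
  moreover have "Z \<subseteq> \<Union>\<V>"
  proof
    fix y assume y: "y \<in> Z"
    have 1: "closedin X K" if "K \<in> {Q \<in> \<Q>. y \<in> Q}" for K using that Q(2) by simp
    have 2: "openin X W" if "W \<in> \<O>" for W using that unfolding \<O>_def by simp
    obtain \<S> \<W> where SW: "finite \<S>" "\<S> \<subseteq> {Q \<in> \<Q>. y \<in> Q}" "finite \<W>" "\<W> \<subseteq> \<O>" "topspace X \<inter> \<Inter>\<S> \<subseteq> \<Union>\<W>"
      using compact_space_finite_intersection_cover[OF X 1 2 order_trans[OF QZ[OF y] cover]] by metis
    have S: "\<S> \<in> \<SS>" using SW unfolding \<SS>_def P_def by blast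
    have "y \<in> topspace X \<inter> \<Inter>\<S>" using SW(2) y Z by blast
    moreover have "topspace X \<inter> \<Inter>\<S> \<subseteq> \<Union>(f \<S>)" using f[OF S] unfolding P_def by simp
    ultimately obtain W where "W \<in> f \<S>" "y \<in> W" by blast
    then show "y \<in> \<Union>\<V>" using S y unfolding \<V>_def by blast
  qed
  moreover have "\<Union>\<V> \<subseteq> topspace (subtopology X Z)"
    using Union_mono[OF VU] U by simp
  ultimately show "\<exists>\<V>. countable \<V> \<and> \<V> \<subseteq> \<U> \<and> \<Union>\<V> = topspace (subtopology X Z)"
    using Z by (intro exI[of _ \<V>]) auto
qed

text \<open>
  The proof closes off a countable \<open>C \<subseteq> H\<close> so that it contains a point of \<open>H \<inter> \<Inter>\<S> - \<Union>\<E>\<close>, if there is one, for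
  finite \<open>\<S> \<subseteq> \<Q>\<close> and finite families \<open>\<E>\<close> of members of \<open>\<A>\<close> that meet \<open>C\<close>. Suppose \<open>y \<in> H\<close> is not in the closure of \<open>C\<close>.
  A point \<open>x\<close> of this closure is interior to the union of a finite \<open>\<F> \<subseteq> \<A>\<close> that misses \<open>y\<close>. The members of \<open>\<F>\<close> that do not
  meet \<open>C\<close> can be dropped: the rest still covers \<open>C\<close> near \<open>x\<close>, although perhaps no longer a neighbourhood of \<open>x\<close>,
  or even \<open>x\<close> itself. By compactness some finite \<open>\<E>\<close> of members meeting \<open>C\<close> misses \<open>y\<close> and covers \<open>C \<inter> \<Inter>\<S>\<close> for
  a finite \<open>\<S>\<close> of members of \<open>\<Q>\<close> around \<open>y\<close>. Then \<open>y\<close> shows that a point outside \<open>\<Union>\<E>\<close> was put into \<open>C \<inter> \<Inter>\<S>\<close>.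
\<close>

lemma hereditarily_separable_if_point_countable_p_metabase:
  assumes X: "compact_space X" and Sig: "Sigma_family X Z \<Q>"
    and A: "p_metabase (subtopology X Z) \<A>" "point_countable (subtopology X Z) \<A>"
    and H: "H \<subseteq> Z"
  obtains C where "countable C" "C \<subseteq> H" "H \<subseteq> X closure_of C"
proof -
  have Q: "countable \<Q>" "\<And>Q. Q \<in> \<Q> \<Longrightarrow> closedin X Q" and Z: "Z \<subseteq> topspace X"
    and QZ: "\<And>y C. y \<in> Z \<Longrightarrow> C \<subseteq> Z \<Longrightarrow> countable C \<Longrightarrow> X closure_of C \<inter> \<Inter>{Q \<in> \<Q>. y \<in> Q} \<subseteq> Z"
    using Sig unfolding Sigma_family_def by auto
  have tZ: "topspace (subtopology X Z) = Z" using Z by auto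
  define G where "G \<S> \<E> = H \<inter> \<Inter>\<S> - \<Union>\<E>" for \<S> \<E>
  define \<Phi> where "\<Phi> \<E> = (\<lambda>\<S>. SOME x. x \<in> G \<S> \<E>) ` {\<S>. (finite \<S> \<and> \<S> \<subseteq> \<Q>) \<and> G \<S> \<E> \<noteq> {}}" for \<E>
  have \<Phi>: "\<Phi> \<E> \<subseteq> H \<and> countable (\<Phi> \<E>)" for \<E>
  proof
    have "(SOME x. x \<in> G \<S> \<E>) \<in> G \<S> \<E>" if "G \<S> \<E> \<noteq> {}" for \<S>
      using that by (simp add: some_in_eq)
    then show "\<Phi> \<E> \<subseteq> H" unfolding \<Phi>_def by (auto simp: G_def)
    have "countable {\<S>. finite \<S> \<and> \<S> \<subseteq> \<Q>}" using Q(1) by (rule countable_Collect_finite_subset)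
    then have "countable {\<S>. (finite \<S> \<and> \<S> \<subseteq> \<Q>) \<and> G \<S> \<E> \<noteq> {}}"
      by (rule countable_subset[rotated]) auto
    then show "countable (\<Phi> \<E>)" unfolding \<Phi>_def by (rule countable_image)
  qed
  have ctb: "countable {A \<in> \<A>. x \<in> A}" if "x \<in> H" for x
    using A(2) H that tZ unfolding point_countable_def by auto
  obtain C where C: "C \<subseteq> H" "countable C"
    "\<And>\<E>. finite \<E> \<Longrightarrow> \<E> \<subseteq> {A \<in> \<A>. A \<inter> C \<noteq> {}} \<Longrightarrow> \<Phi> \<E> \<subseteq> C"
    using countable_closing_off[of H \<A> \<Phi>, OF ctb \<Phi>] by blast
  have CZ: "C \<subseteq> Z" "C \<subseteq> topspace X" using C H Z by auto
  have "y \<in> X closure_of C" if y: "y \<in> H" for y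
  proof (rule ccontr)
    assume ny: "y \<notin> X closure_of C"
    define \<AA> where "\<AA> = {\<E>. finite \<E> \<and> \<E> \<subseteq> {A \<in> \<A>. A \<inter> C \<noteq> {}} \<and> y \<notin> \<Union>\<E>}"
    \<comment> \<open>The points near which \<open>\<E>\<close> covers \<open>C\<close>.\<close>
    define V where "V \<E> = topspace X - X closure_of (C - \<Union>\<E>)" for \<E>
    define \<K> where "\<K> = insert (X closure_of C) {Q \<in> \<Q>. y \<in> Q}"
    have cover: "topspace X \<inter> \<Inter>\<K> \<subseteq> \<Union>(V ` \<AA>)"
    proof
      fix x assume x: "x \<in> topspace X \<inter> \<Inter>\<K>"
      then have "x \<in> X closure_of C \<inter> \<Inter>{Q \<in> \<Q>. y \<in> Q}" unfolding \<K>_def by blast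
      then have xZ: "x \<in> Z" "x \<noteq> y" "y \<in> Z" using QZ[of y C] CZ(1) C(2) y H ny by blast+
      then obtain \<F> where F: "finite \<F>" "\<F> \<subseteq> \<A>" "x \<in> subtopology X Z interior_of \<Union>\<F>" "\<Union>\<F> \<subseteq> Z - {y}"
        using A(1) unfolding p_metabase_def tZ by metis
      obtain W where W: "openin X W" "subtopology X Z interior_of \<Union>\<F> = W \<inter> Z"
        using openin_interior_of by (metis openin_subtopology)
      have WF: "W \<inter> Z \<subseteq> \<Union>\<F>" unfolding W(2)[symmetric] by (rule interior_of_subset)
      define \<E> where "\<E> = {A \<in> \<F>. A \<inter> C \<noteq> {}}"
      have "W \<inter> (C - \<Union>\<E>) = {}"
      proof (rule ccontr)
        assume "W \<inter> (C - \<Union>\<E>) \<noteq> {}"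
        then obtain c where c: "c \<in> W" "c \<in> C" "c \<notin> \<Union>\<E>" by blast
        then have "c \<in> \<Union>\<F>" using WF CZ(1) by blast
        then show False using c unfolding \<E>_def by blast
      qed
      then have "W \<inter> X closure_of (C - \<Union>\<E>) = {}"
        using W(1) by (simp add: openin_Int_closure_of_eq_empty)
      then have "x \<in> V \<E>" using x W(2) F(3) unfolding V_def by blast
      moreover have "\<E> \<in> \<AA>" using F unfolding \<AA>_def \<E>_def by auto
      ultimately show "x \<in> \<Union>(V ` \<AA>)" by blast
    qed
    have 1: "closedin X K" if "K \<in> \<K>" for K using that Q(2) unfolding \<K>_def by auto
    have 2: "openin X W" if "W \<in> V ` \<AA>" for W using that unfolding V_def by auto
    obtain \<S> \<W> where SW: "finite \<S>" "\<S> \<subseteq> \<K>" "finite \<W>" "\<W> \<subseteq> V ` \<AA>" "topspace X \<inter> \<Inter>\<S> \<subseteq> \<Union>\<W>"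
      using compact_space_finite_intersection_cover[OF X 1 2 cover] by metis
    obtain \<BB> where BB: "\<BB> \<subseteq> \<AA>" "finite \<BB>" "\<W> = V ` \<BB>" using SW(3,4) finite_subset_image by metis
    define \<T> where "\<T> = \<S> \<inter> {Q \<in> \<Q>. y \<in> Q}"
    have CT: "C \<inter> \<Inter>\<T> \<subseteq> \<Union>(\<Union>\<BB>)"
    proof
      fix c assume c: "c \<in> C \<inter> \<Inter>\<T>"
      have "c \<in> X closure_of C" using c closure_of_subset[OF CZ(2)] by blast
      moreover have "\<S> \<subseteq> insert (X closure_of C) \<T>" using SW(2) unfolding \<T>_def \<K>_def by auto
      ultimately have "\<forall>K\<in>\<S>. c \<in> K" using c by auto
      then have "c \<in> topspace X \<inter> \<Inter>\<S>" using c CZ(2) by auto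
      then obtain \<E> where E: "\<E> \<in> \<BB>" "c \<in> V \<E>" using SW(5) BB(3) by blast
      have "C - \<Union>\<E> \<subseteq> X closure_of (C - \<Union>\<E>)" using CZ by (intro closure_of_subset) auto
      then have "c \<in> \<Union>\<E>" using E(2) c unfolding V_def by blast
      then show "c \<in> \<Union>(\<Union>\<BB>)" using E(1) by blast
    qed
    have fin: "finite (\<Union>\<BB>)" "\<Union>\<BB> \<subseteq> {A \<in> \<A>. A \<inter> C \<noteq> {}}" "y \<notin> \<Union>(\<Union>\<BB>)"
      using BB unfolding \<AA>_def by auto
    have ne: "y \<in> G \<T> (\<Union>\<BB>)" using y fin unfolding G_def \<T>_def by blast
    have T: "finite \<T>" "\<T> \<subseteq> \<Q>" using SW(1) unfolding \<T>_def by auto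
    define x where "x = (SOME x. x \<in> G \<T> (\<Union>\<BB>))"
    have "x \<in> G \<T> (\<Union>\<BB>)" unfolding x_def using ne by (metis someI)
    then have xG: "x \<in> \<Inter>\<T>" "x \<notin> \<Union>(\<Union>\<BB>)" unfolding G_def by auto
    have "x \<in> \<Phi> (\<Union>\<BB>)"
      unfolding \<Phi>_def x_def by (rule imageI) (use ne T in auto)
    then have "x \<in> C" using C(3)[OF fin(1,2)] by (rule rev_subsetD)
    then show False using subsetD[OF CT IntI] xG by metis
  qed
  then have "H \<subseteq> X closure_of C" by (rule subsetI)
  then show thesis using that C(1,2) by metis
qed

text \<open>
  By hereditary separability a countable \<open>C\<close> can be closed off so that \<open>C - \<Union>\<E>\<close> is dense in \<open>Z - \<Union>\<E>\<close> for
  all finite families \<open>\<E>\<close> of members of \<open>\<A>\<close> that meet \<open>C\<close>. Then the members that meet \<open>C\<close>, of which there are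
  countably many, form a p-metabase: if \<open>W \<inter> Z\<close> is the interior of \<open>\<Union>\<F>\<close> and \<open>\<E>\<close> consists of the members of \<open>\<F>\<close> that
  meet \<open>C\<close>, then \<open>\<E>\<close> still covers \<open>W \<inter> C\<close>, so the open set \<open>W\<close> misses \<open>C - \<Union>\<E>\<close> and with it \<open>Z - \<Union>\<E>\<close>.
\<close>

lemma countable_p_metabase_if_point_countable:
  assumes X: "compact_space X" and Sig: "Sigma_family X Z \<Q>"
    and A: "p_metabase (subtopology X Z) \<A>" "point_countable (subtopology X Z) \<A>"
  obtains \<B> where "countable \<B>" "p_metabase (subtopology X Z) \<B>"
proof -
  let ?Z = "subtopology X Z"
  have Z: "Z \<subseteq> topspace X" using Sig unfolding Sigma_family_def by auto
  then have tZ: "topspace ?Z = Z" by auto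
  have "\<exists>C. countable C \<and> C \<subseteq> Z - \<Union>\<E> \<and> Z - \<Union>\<E> \<subseteq> X closure_of C" for \<E>
    using hereditarily_separable_if_point_countable_p_metabase[OF X Sig A, of "Z - \<Union>\<E>"]
    by (metis Diff_subset)
  then obtain \<Phi> where \<Phi>: "\<And>\<E>. countable (\<Phi> \<E>)" "\<And>\<E>. \<Phi> \<E> \<subseteq> Z - \<Union>\<E>"
    "\<And>\<E>. Z - \<Union>\<E> \<subseteq> X closure_of (\<Phi> \<E>)" by metis
  have ctb: "countable {A \<in> \<A>. x \<in> A}" if "x \<in> Z" for x
    using A(2) that tZ unfolding point_countable_def by auto
  have \<Phi>Z: "\<Phi> \<E> \<subseteq> Z \<and> countable (\<Phi> \<E>)" for \<E> using \<Phi> by blast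
  obtain C where C: "C \<subseteq> Z" "countable C"
    "\<And>\<E>. finite \<E> \<Longrightarrow> \<E> \<subseteq> {A \<in> \<A>. A \<inter> C \<noteq> {}} \<Longrightarrow> \<Phi> \<E> \<subseteq> C"
    using countable_closing_off[of Z \<A> \<Phi>, OF ctb \<Phi>Z] by blast
  define \<B> where "\<B> = {A \<in> \<A>. A \<inter> C \<noteq> {}}"
  have "\<B> = (\<Union>c\<in>C. {A \<in> \<A>. c \<in> A})" unfolding \<B>_def by auto
  then have "countable \<B>" using C(2) subsetD[OF C(1)] ctb by (simp add: countable_UN)
  moreover have "p_metabase ?Z \<B>"
    unfolding p_metabase_def
  proof (intro conjI ballI impI)
    show "\<B> \<subseteq> Pow (topspace ?Z)" using A(1) unfolding p_metabase_def \<B>_def by auto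
    fix x y assume xy: "x \<in> topspace ?Z" "y \<in> topspace ?Z" "x \<noteq> y"
    then obtain \<F> where F: "finite \<F>" "\<F> \<subseteq> \<A>" "x \<in> ?Z interior_of \<Union>\<F>" "\<Union>\<F> \<subseteq> topspace ?Z - {y}"
      using A(1) unfolding p_metabase_def by metis
    define \<E> where "\<E> = \<F> \<inter> \<B>"
    have E: "finite \<E>" "\<E> \<subseteq> \<B>" using F unfolding \<E>_def by auto
    obtain W where W: "openin X W" "?Z interior_of \<Union>\<F> = W \<inter> Z"
      using openin_interior_of by (metis openin_subtopology)
    have WF: "W \<inter> Z \<subseteq> \<Union>\<F>" unfolding W(2)[symmetric] by (rule interior_of_subset)
    have "W \<inter> (C - \<Union>\<E>) = {}"
    proof (rule ccontr)
      assume "W \<inter> (C - \<Union>\<E>) \<noteq> {}"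
      then obtain c where c: "c \<in> W" "c \<in> C" "c \<notin> \<Union>\<E>" by blast
      then have "c \<in> \<Union>\<F>" using WF C(1) by blast
      then show False using c F(2) unfolding \<E>_def \<B>_def by blast
    qed
    moreover have "\<Phi> \<E> \<subseteq> C - \<Union>\<E>" using C(3)[OF E[unfolded \<B>_def]] \<Phi>(2)[of \<E>] by blast
    ultimately have "W \<inter> \<Phi> \<E> = {}" by blast
    then have "W \<inter> X closure_of \<Phi> \<E> = {}" using W(1) by (simp add: openin_Int_closure_of_eq_empty)
    then have "W \<inter> Z \<subseteq> \<Union>\<E>" using \<Phi>(3)[of \<E>] by blast
    moreover have "openin ?Z (W \<inter> Z)" using W(1) by (simp add: openin_subtopology_Int)
    ultimately have "W \<inter> Z \<subseteq> ?Z interior_of \<Union>\<E>" by (rule interior_of_maximal)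
    then have "x \<in> ?Z interior_of \<Union>\<E>" using F(3) W(2) by blast
    moreover have "\<Union>\<E> \<subseteq> topspace ?Z - {y}" using F(4) unfolding \<E>_def by blast
    ultimately show "\<exists>\<F>. finite \<F> \<and> \<F> \<subseteq> \<B> \<and> x \<in> ?Z interior_of \<Union>\<F> \<and> \<Union>\<F> \<subseteq> topspace ?Z - {y}"
      using E by blast
  qed
  ultimately show thesis using that by blast
qed

section \<open>Remainders with point-countable p-metabases\<close>

text \<open>
  A point of \<open>S\<close> has a relatively closed neighbourhood \<open>Z\<close> with a point-countable p-metabase. Since \<open>Z\<close>
  contains the closures of its countable subsets, it is separable and therefore the closure of a
  countable set. So \<open>Z\<close> is closed in \<open>X\<close>, and as \<open>S\<close> is dense, \<open>Z\<close> contains a neighbourhood of the point in \<open>X\<close>.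
\<close>

lemma openin_if_closed_under_countable_closures:
  assumes X: "compact_space X" "Hausdorff_space X" and S: "S \<subseteq> topspace X" "X closure_of S = topspace X"
    and loc: "has_locally has_point_countable_p_metabase (subtopology X S)"
    and cl: "\<And>D. D \<subseteq> S \<Longrightarrow> countable D \<Longrightarrow> X closure_of D \<subseteq> S"
  shows "openin X S"
proof -
  have reg: "regular_space X" using compact_Hausdorff_imp_regular_space X by blast
  have "\<exists>V. openin X V \<and> y \<in> V \<and> V \<subseteq> S" if y: "y \<in> S" for y
  proof -
    have "y \<in> topspace (subtopology X S)" using y S(1) by auto
    then obtain U where U: "openin (subtopology X S) U" "y \<in> U"
      "has_point_countable_p_metabase (subtopology (subtopology X S) U)"
      using loc unfolding has_locally_def by blast
    obtain W where W: "openin X W" "U = W \<inter> S" using U(1) unfolding openin_subtopology by blast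
    obtain V where V: "openin X V" "y \<in> V" "X closure_of V \<subseteq> W"
      using regular_space_closure_neighbourhood[OF reg W(1)] U(2) W(2) by blast
    define Z where "Z = X closure_of V \<inter> S"
    have sub: "subtopology (subtopology X S) U = subtopology X U"
      using W(2) by (simp add: subtopology_subtopology Int_absorb1)
    have ZU: "Z \<subseteq> U" unfolding Z_def W(2) using V(3) by blast
    obtain \<A> where A: "p_metabase (subtopology X Z) \<A>" "point_countable (subtopology X Z) \<A>"
      using has_point_countable_p_metabase_subset[OF U(3)[unfolded sub] ZU]
      unfolding has_point_countable_p_metabase_def by blast
    have "X closure_of C \<subseteq> Z" if "C \<subseteq> Z" "countable C" for C
    proof -
      have "C \<subseteq> S" "C \<subseteq> X closure_of V" using that(1) unfolding Z_def by auto
      then show ?thesis using cl[OF _ that(2)] closure_of_minimal[of C "X closure_of V" X] unfolding Z_def by auto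
    qed
    moreover have "Z \<subseteq> topspace X" unfolding Z_def using S(1) by blast
    ultimately have "Sigma_family X Z {}" by (intro Sigma_family_empty)
    from hereditarily_separable_if_point_countable_p_metabase[OF X(1) this A subset_refl]
    obtain C where C: "countable C" "C \<subseteq> Z" "Z \<subseteq> X closure_of C" by metis
    have "V \<subseteq> X closure_of V" using V(1) by (simp add: closure_of_subset openin_subset)
    also have "\<dots> = X closure_of (V \<inter> S)"
      using closure_of_openin_Int_superset[of X V S] V(1) S(2) openin_subset by auto
    also have "\<dots> \<subseteq> X closure_of Z"
      unfolding Z_def using V(1) closure_of_subset[of V X] openin_subset by (intro closure_of_mono) blast
    also have "\<dots> \<subseteq> X closure_of C" using closure_of_mono[OF C(3), of X] by simp
    also have "\<dots> \<subseteq> S" using cl[of C] C(1,2) unfolding Z_def by blast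
    finally show ?thesis using V(1,2) by blast
  qed
  then show ?thesis by (subst openin_subopen) blast
qed

text \<open>
  A countable base of \<open>S\<close> extends to countably many open sets \<open>w B\<close> of \<open>X\<close>, and the complements of the \<open>w B\<close> together
  with the closures of the \<open>w B\<close> form a Sigma family for the remainder \<open>Z\<close>. Hence \<open>Z\<close> is Lindelof, so that
  the local p-metabases combine to a point-countable and then to a countable one. Distinct points of \<open>X\<close> are
  separated by disjoint members of the countable family \<open>\<N>\<close> of closed sets that are built from all these sets.
  For \<open>x, y \<in> Z\<close> the reason is as follows: every point of the compact set \<open>K\<close> around \<open>x\<close> differs from \<open>x\<close> or from \<open>y\<close>,
  so \<open>K\<close> is covered by finitely many interiors of unions of p-metabase members, each of which misses \<open>x\<close> or \<open>y\<close>.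
  Some finite intersection of members of \<open>\<Q>\<close> around \<open>x\<close> is covered by them as well. Removing from it the sets that miss \<open>x\<close>,
  and from \<open>X\<close> the sets that contain \<open>x\<close>, leaves disjoint closed sets that contain \<open>x\<close> and \<open>y\<close>.
\<close>

lemma metrizable_if_second_countable_dense_subspace:
  assumes X: "compact_space X" "Hausdorff_space X" and dense: "X closure_of S = topspace X"
    and S: "S \<subseteq> topspace X" and sc: "second_countable (subtopology X S)"
    and loc: "has_locally has_point_countable_p_metabase (subtopology X (topspace X - S))"
  shows "metrizable_space X"
proof -
  define Z where "Z = topspace X - S"
  let ?Z = "subtopology X Z"
  have tZ: "topspace ?Z = Z" "Z \<subseteq> topspace X" unfolding Z_def by auto
  have reg: "regular_space X" using compact_Hausdorff_imp_regular_space X by blast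
  obtain \<B> where B: "countable \<B>" "\<And>B. B \<in> \<B> \<Longrightarrow> openin (subtopology X S) B"
    "\<And>U x. openin (subtopology X S) U \<Longrightarrow> x \<in> U \<Longrightarrow> \<exists>B\<in>\<B>. x \<in> B \<and> B \<subseteq> U"
    using sc unfolding second_countable_def by metis
  have "\<forall>B\<in>\<B>. \<exists>W. openin X W \<and> B = W \<inter> S" using B(2) unfolding openin_subtopology by blast
  from bchoice[OF this] obtain w where "\<forall>B\<in>\<B>. openin X (w B) \<and> B = w B \<inter> S" by blast
  then have w: "\<And>B. B \<in> \<B> \<Longrightarrow> openin X (w B)" "\<And>B. B \<in> \<B> \<Longrightarrow> B = w B \<inter> S" by auto
  have wcl: "w B \<subseteq> X closure_of (w B)" if "B \<in> \<B>" for B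
    using w(1)[OF that] by (simp add: closure_of_subset openin_subset)
  have base: "\<exists>B\<in>\<B>. g \<in> w B \<and> X closure_of (w B) \<subseteq> W" if W: "openin X W" "g \<in> W" and g: "g \<in> S" for g W
  proof -
    obtain U where U: "openin X U" "g \<in> U" "X closure_of U \<subseteq> W"
      using regular_space_closure_neighbourhood[OF reg W] by blast
    obtain B0 where B0: "B0 \<in> \<B>" "g \<in> B0" "B0 \<subseteq> U \<inter> S"
      using B(3)[of "U \<inter> S" g] U g by (auto simp: openin_subtopology_Int)
    have "X closure_of (w B0) = X closure_of (w B0 \<inter> S)"
      using closure_of_openin_Int_superset[of X "w B0" S] w(1)[OF B0(1)] dense openin_subset by auto
    also have "\<dots> \<subseteq> X closure_of U" using B0(3) w(2)[OF B0(1)] by (intro closure_of_mono) auto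
    finally show ?thesis using U(3) B0 w(2)[OF B0(1)] by blast
  qed
  have nbhd: "openin X (topspace X - {y})" if "y \<in> topspace X" for y
    using that X(2) by (simp add: closedin_Hausdorff_singleton openin_diff)
  define \<Q> where "\<Q> = (\<lambda>B. topspace X - w B) ` \<B> \<union> (\<lambda>B. X closure_of (w B)) ` \<B>"
  have Q: "countable \<Q>" "\<And>Q. Q \<in> \<Q> \<Longrightarrow> closedin X Q"
    unfolding \<Q>_def using B(1) w(1) by auto
  have QZ: "topspace X \<inter> \<Inter>{Q \<in> \<Q>. y \<in> Q} \<subseteq> Z" if y: "y \<in> Z" for y
  proof (rule subsetI, rule ccontr)
    fix g assume g: "g \<in> topspace X \<inter> \<Inter>{Q \<in> \<Q>. y \<in> Q}" "g \<notin> Z"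
    then have gS: "g \<in> S" "g \<in> topspace X - {y}" using y unfolding Z_def by auto
    then obtain B0 where B0: "B0 \<in> \<B>" "g \<in> w B0" "X closure_of (w B0) \<subseteq> topspace X - {y}"
      using base[OF nbhd, of y g] y unfolding Z_def by blast
    then have "y \<in> topspace X - w B0" using wcl[OF B0(1)] y unfolding Z_def by blast
    then have "topspace X - w B0 \<in> {Q \<in> \<Q>. y \<in> Q}" unfolding \<Q>_def using B0(1) by blast
    then show False using g(1) B0(2) by blast
  qed
  have Sig: "Sigma_family X Z \<Q>" using Q tZ(2) QZ by (rule Sigma_familyI)
  have "Lindelof_space ?Z" using X(1) Q tZ(2) QZ by (rule Lindelof_space_if_countable_closed_family)
  then obtain \<A>0 where "p_metabase ?Z \<A>0" "point_countable ?Z \<A>0"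
    using Lindelof_has_point_countable_p_metabase_if_locally loc
    unfolding has_point_countable_p_metabase_def Z_def by blast
  then obtain \<A> where A: "countable \<A>" "p_metabase ?Z \<A>"
    using countable_p_metabase_if_point_countable[OF X(1) Sig] by metis
  \<comment> \<open>The largest open set of \<open>X\<close> whose trace on \<open>Z\<close> is the interior of \<open>\<Union>\<E>\<close> in \<open>Z\<close>.\<close>
  define v where "v \<E> = topspace X - X closure_of (Z - ?Z interior_of \<Union>\<E>)" for \<E>
  have v_Z: "v \<E> \<inter> Z = ?Z interior_of \<Union>\<E>" for \<E>
  proof -
    have "closedin ?Z (Z - ?Z interior_of \<Union>\<E>)"
      using tZ(1) by (metis closedin_diff closedin_topspace openin_interior_of)
    then have "Z \<inter> X closure_of (Z - ?Z interior_of \<Union>\<E>) = Z - ?Z interior_of \<Union>\<E>"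
      using tZ(2) by (metis closedin_Int_closure_of closure_of_subtopology closure_of_closedin Diff_subset inf.absorb_iff2)
    moreover have "?Z interior_of \<Union>\<E> \<subseteq> Z" using interior_of_subset_topspace[of ?Z] tZ(1) by simp
    ultimately show ?thesis using tZ(2) unfolding v_def by blast
  qed
  define \<V> where "\<V> = v ` {\<E>. finite \<E> \<and> \<E> \<subseteq> \<A>} \<union> w ` \<B>"
  have V: "countable \<V>" "\<And>V. V \<in> \<V> \<Longrightarrow> openin X V"
    unfolding \<V>_def v_def using B(1) w(1) countable_Collect_finite_subset[OF A(1)] by auto
  define n where "n = (\<lambda>(\<S>, \<F>). topspace X \<inter> \<Inter>\<S> - \<Union>\<F> :: 'a set)"
  define \<N> where "\<N> = n ` ({\<S>. finite \<S> \<and> \<S> \<subseteq> \<Q>} \<times> {\<F>. finite \<F> \<and> \<F> \<subseteq> \<V>})"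
  have "countable \<N>"
    unfolding \<N>_def using countable_Collect_finite_subset[OF Q(1)] countable_Collect_finite_subset[OF V(1)]
    by (intro countable_image countable_SIGMA)
  have N_mem: "topspace X \<inter> \<Inter>\<S> - \<Union>\<F> \<in> \<N>"
    if "finite \<S>" "\<S> \<subseteq> \<Q>" "finite \<F>" "\<F> \<subseteq> \<V>" for \<S> \<F>
    unfolding \<N>_def by (rule image_eqI[of _ _ "(\<S>, \<F>)"]) (use that in \<open>auto simp: n_def\<close>)
  have N_closed: "closedin X N" if "N \<in> \<N>" for N
  proof -
    obtain \<S> \<F> where SF: "N = topspace X \<inter> \<Inter>\<S> - \<Union>\<F>" "\<S> \<subseteq> \<Q>" "\<F> \<subseteq> \<V>"
      using \<open>N \<in> \<N>\<close> unfolding \<N>_def n_def by auto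
    have "N = \<Inter>(insert (topspace X) \<S>) - \<Union>\<F>" using SF(1) by auto
    moreover have "closedin X (\<Inter>(insert (topspace X) \<S>))" using SF(2) Q(2) by (intro closedin_Inter) auto
    moreover have "openin X (\<Union>\<F>)" using SF(3) V(2) by (intro openin_Union) auto
    ultimately show ?thesis by (simp add: closedin_diff)
  qed
  have sepS: "\<exists>N\<in>\<N>. \<exists>M\<in>\<N>. disjnt N M \<and> x \<in> N \<and> y \<in> M"
    if xy: "x \<in> topspace X" "y \<in> topspace X" "x \<noteq> y" "x \<in> S" for x y
  proof -
    have "x \<in> topspace X - {y}" using xy by simp
    then obtain B1 where B1: "B1 \<in> \<B>" "x \<in> w B1" "X closure_of (w B1) \<subseteq> topspace X - {y}"
      using base[OF nbhd[OF xy(2)]] xy(4) by blast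
    obtain B2 where B2: "B2 \<in> \<B>" "x \<in> w B2" "X closure_of (w B2) \<subseteq> w B1"
      using base[OF w(1)[OF B1(1)] B1(2) xy(4)] by blast
    have "topspace X \<inter> \<Inter>{X closure_of (w B2)} - \<Union>{} \<in> \<N>"
      by (rule N_mem) (use B2(1) in \<open>auto simp: \<Q>_def\<close>)
    moreover have "topspace X \<inter> \<Inter>{} - \<Union>{w B1} \<in> \<N>"
      by (rule N_mem) (use B1(1) in \<open>auto simp: \<V>_def\<close>)
    moreover have "x \<in> X closure_of (w B2)" "y \<notin> w B1" using wcl[OF B1(1)] wcl[OF B2(1)] B1(3) B2(2) by auto
    ultimately show ?thesis using B2(3) xy(1,2)
      by (intro bexI[of _ "topspace X \<inter> \<Inter>{X closure_of (w B2)} - \<Union>{}"]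
            bexI[of _ "topspace X \<inter> \<Inter>{} - \<Union>{w B1}"]) (auto simp: disjnt_def)
  qed
  have sepZ: "\<exists>N\<in>\<N>. \<exists>M\<in>\<N>. disjnt N M \<and> x \<in> N \<and> y \<in> M"
    if xy: "x \<in> Z" "y \<in> Z" "x \<noteq> y" for x y
  proof -
    define \<O> where "\<O> = v ` {\<E>. (finite \<E> \<and> \<E> \<subseteq> \<A>) \<and> (x \<notin> \<Union>\<E> \<or> y \<notin> \<Union>\<E>)}"
    have "Z \<subseteq> \<Union>\<O>"
    proof
      fix k assume k: "k \<in> Z"
      obtain p where p: "p \<in> {x, y}" "p \<noteq> k" using xy(3) by blast
      then obtain \<E> where E: "finite \<E>" "\<E> \<subseteq> \<A>" "k \<in> ?Z interior_of \<Union>\<E>" "\<Union>\<E> \<subseteq> Z - {p}"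
        using A(2) k xy unfolding p_metabase_def tZ(1) by (metis insertE singletonD)
      have "k \<in> v \<E>" using v_Z E(3) by blast
      moreover have "x \<notin> \<Union>\<E> \<or> y \<notin> \<Union>\<E>" using p(1) E(4) by blast
      then have "v \<E> \<in> \<O>" unfolding \<O>_def using E(1,2) by (intro imageI CollectI conjI)
      ultimately show "k \<in> \<Union>\<O>" by (rule UnionI[rotated])
    qed
    then have cover: "topspace X \<inter> \<Inter>{Q \<in> \<Q>. x \<in> Q} \<subseteq> \<Union>\<O>" using QZ[OF xy(1)] by (rule order_trans[rotated])
    have OV: "\<O> \<subseteq> \<V>" unfolding \<O>_def \<V>_def by auto
    have 1: "closedin X K" if "K \<in> {Q \<in> \<Q>. x \<in> Q}" for K using that Q(2) by simp
    have 2: "openin X W" if "W \<in> \<O>" for W using that OV V(2) by blast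
    obtain \<S> \<W> where SW: "finite \<S>" "\<S> \<subseteq> {Q \<in> \<Q>. x \<in> Q}" "finite \<W>" "\<W> \<subseteq> \<O>" "topspace X \<inter> \<Inter>\<S> \<subseteq> \<Union>\<W>"
      by (rule compact_space_finite_intersection_cover[OF X(1) 1 2 cover])
    have xor: "x \<notin> W \<or> y \<notin> W" if "W \<in> \<W>" for W
    proof -
      obtain \<E> where E: "W = v \<E>" "x \<notin> \<Union>\<E> \<or> y \<notin> \<Union>\<E>"
        using subsetD[OF SW(4) \<open>W \<in> \<W>\<close>] unfolding \<O>_def by (auto elim!: imageE)
      have "W \<inter> Z \<subseteq> \<Union>\<E>" unfolding E(1) v_Z by (rule interior_of_subset)
      then show ?thesis using E(2) xy(1,2) by blast
    qed
    define N where "N = topspace X \<inter> \<Inter>\<S> - \<Union>{W \<in> \<W>. x \<notin> W}"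
    define M where "M = topspace X \<inter> \<Inter>{} - \<Union>{W \<in> \<W>. x \<in> W}"
    have "N \<in> \<N>" unfolding N_def by (rule N_mem) (use SW OV in auto)
    moreover have "M \<in> \<N>" unfolding M_def by (rule N_mem) (use SW OV in auto)
    moreover have "disjnt N M"
    proof -
      have "a \<notin> M" if a: "a \<in> N" for a
      proof -
        have "a \<in> \<Union>\<W>" using subsetD[OF SW(5)] a unfolding N_def by simp
        then obtain W where W: "W \<in> \<W>" "a \<in> W" by (rule UnionE)
        then have "x \<in> W" using a unfolding N_def by auto
        then show ?thesis using W unfolding M_def by auto
      qed
      then show ?thesis unfolding disjnt_iff by metis
    qed
    moreover have "x \<in> N" unfolding N_def using SW(2) subsetD[OF tZ(2) xy(1)] by auto
    moreover have "y \<in> M" unfolding M_def using xor subsetD[OF tZ(2) xy(2)] by auto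
    ultimately show ?thesis by metis
  qed
  show ?thesis
  proof (rule compact_Hausdorff_metrizable_if_disjoint_closed_separation[OF X \<open>countable \<N>\<close> N_closed])
    fix x y assume xy: "x \<in> topspace X" "y \<in> topspace X" "x \<noteq> y"
    consider "x \<in> S" | "y \<in> S" | "x \<in> Z" "y \<in> Z" using xy unfolding Z_def by blast
    then show "\<exists>N\<in>\<N>. \<exists>M\<in>\<N>. disjnt N M \<and> x \<in> N \<and> y \<in> M"
    proof cases
      case 1 then show ?thesis using sepS xy by metis
    next
      case 2
      then obtain N M where "N \<in> \<N>" "M \<in> \<N>" "disjnt N M" "y \<in> N" "x \<in> M"
        using sepS[OF xy(2,1)] xy(3) by metis
      then show ?thesis using disjnt_sym by metis
    next
      case 3 then show ?thesis using sepZ xy(3) by metis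
    qed
  qed
qed

section \<open>Countable local \<pi>-bases\<close>

text \<open>
  An open set of \<open>X\<close> has the same closure as its trace on the dense set \<open>S\<close>. In a regular space this
  places any open extension of a small member of \<open>\<U>\<close> inside a given neighbourhood.
\<close>

lemma local_pi_base_dense_superspace:
  assumes reg: "regular_space X" and dense: "X closure_of S = topspace X" and "y \<in> S"
    and base: "countable \<U>" "local_pi_base (subtopology X S) y \<U>"
  shows "\<exists>\<W>. countable \<W> \<and> local_pi_base X y \<W>"
proof -
  have "\<forall>U\<in>\<U>. \<exists>W. openin X W \<and> U = W \<inter> S"
    using base(2) unfolding local_pi_base_def openin_subtopology by metis
  from bchoice[OF this] obtain w where w: "\<forall>U\<in>\<U>. openin X (w U) \<and> U = w U \<inter> S" by blast
  have "local_pi_base X y (w ` \<U>)"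
    unfolding local_pi_base_def
  proof (intro conjI ballI allI impI)
    fix W assume "W \<in> w ` \<U>"
    then obtain U where U: "U \<in> \<U>" "W = w U" by blast
    show "openin X W" using U w by blast
    show "W \<noteq> {}" using U w base(2) unfolding local_pi_base_def by fastforce
  next
    fix V assume V: "openin X V \<and> y \<in> V"
    then obtain V' where V': "openin X V'" "y \<in> V'" "X closure_of V' \<subseteq> V"
      using regular_space_closure_neighbourhood[OF reg] by metis
    have "openin (subtopology X S) (V' \<inter> S) \<and> y \<in> V' \<inter> S"
      using V' assms(3) by (simp add: openin_subtopology_Int)
    then obtain U where U: "U \<in> \<U>" "U \<subseteq> V' \<inter> S" using base(2) unfolding local_pi_base_def by blast
    have op: "openin X (w U)" "U = w U \<inter> S" using U(1) w by auto
    have "w U \<subseteq> X closure_of (w U)" using op(1) by (simp add: closure_of_subset openin_subset)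
    also have "\<dots> = X closure_of (w U \<inter> S)"
      using closure_of_openin_Int_superset[of X "w U" S] op(1) dense openin_subset by auto
    also have "\<dots> \<subseteq> X closure_of V'" using U op(2) by (intro closure_of_mono) auto
    finally have "w U \<subseteq> V" using V'(3) by blast
    then show "\<exists>U\<in>w ` \<U>. U \<subseteq> V" using U(1) by blast
  qed
  then show ?thesis using base(1) by blast
qed

lemma local_pi_base_dense_subspace:
  assumes dense: "X closure_of S = topspace X" and base: "local_pi_base X z \<W>"
  shows "local_pi_base (subtopology X S) z ((\<lambda>W. W \<inter> S) ` \<W>)"
  unfolding local_pi_base_def
proof (intro conjI ballI allI impI)
  fix U assume "U \<in> (\<lambda>W. W \<inter> S) ` \<W>"
  then obtain W where W: "U = W \<inter> S" "openin X W" "W \<noteq> {}" using base unfolding local_pi_base_def by blast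
  then show "openin (subtopology X S) U" by (simp add: openin_subtopology_Int)
  show "U \<noteq> {}" using W dense unfolding dense_intersects_open by blast
next
  fix V assume "openin (subtopology X S) V \<and> z \<in> V"
  then obtain V' where "openin X V'" "V = V' \<inter> S" "z \<in> V'" unfolding openin_subtopology by blast
  moreover obtain W where "W \<in> \<W>" "W \<subseteq> V'" using base calculation(1,3) unfolding local_pi_base_def by metis
  ultimately show "\<exists>U\<in>(\<lambda>W. W \<inter> S) ` \<W>. U \<subseteq> V" by (intro bexI[of _ "W \<inter> S"]) auto
qed

lemma local_pi_base_closure_point:
  assumes "countable D" and base: "\<And>y. y \<in> D \<Longrightarrow> \<exists>\<U>. countable \<U> \<and> local_pi_base X y \<U>"
    and "z \<in> X closure_of D"
  shows "\<exists>\<U>. countable \<U> \<and> local_pi_base X z \<U>"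
proof -
  obtain u where u: "\<And>y. y \<in> D \<Longrightarrow> countable (u y)" "\<And>y. y \<in> D \<Longrightarrow> local_pi_base X y (u y)"
    using base by metis
  have "local_pi_base X z (\<Union>(u ` D))"
    unfolding local_pi_base_def
  proof (intro conjI ballI allI impI)
    fix V assume "openin X V \<and> z \<in> V"
    then obtain y where y: "y \<in> D" "y \<in> V" "openin X V" using assms(3) unfolding in_closure_of by blast
    then obtain U where "U \<in> u y" "U \<subseteq> V" using u(2)[OF y(1)] unfolding local_pi_base_def by meson
    then show "\<exists>U\<in>\<Union>(u ` D). U \<subseteq> V" using y(1) by auto
  next
    fix U assume "U \<in> \<Union>(u ` D)"
    then obtain y where y: "y \<in> D" "U \<in> u y" by blast
    show "openin X U" "U \<noteq> {}" using u(2)[OF y(1)] y(2) unfolding local_pi_base_def by simp_all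
  qed
  moreover have "countable (\<Union>(u ` D))" using assms(1) u(1) by (simp add: countable_UN)
  ultimately show ?thesis by blast
qed

section \<open>Topological groups\<close>

context topological_group
begin

lemma continuous_map_left_translation:
  assumes "g \<in> carrier G"
  shows "continuous_map T T (\<lambda>x. g \<otimes> x)"
proof -
  have "continuous_map T (prod_topology T T) (\<lambda>x. (g, x))"
    using assms topspace_eq_carrier by (simp add: continuous_map_paired)
  from continuous_map_compose[OF this continuous_mult] show ?thesis by (simp add: o_def)
qed

lemma openin_left_translation:
  assumes g: "g \<in> carrier G" and U: "openin T U"
  shows "openin T ((\<lambda>x. g \<otimes> x) ` U)"
proof -
  have sub: "U \<subseteq> carrier G" using openin_subset[OF U] topspace_eq_carrier by auto
  have "(\<lambda>x. g \<otimes> x) ` U = {x \<in> topspace T. inv g \<otimes> x \<in> U}"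
  proof (intro equalityI subsetI)
    fix x assume "x \<in> (\<lambda>x. g \<otimes> x) ` U"
    then obtain u where u: "u \<in> U" "x = g \<otimes> u" by blast
    then have "inv g \<otimes> x = u" using g sub by (simp add: inv_solve_left' subset_iff m_assoc[symmetric])
    then show "x \<in> {x \<in> topspace T. inv g \<otimes> x \<in> U}" using u g sub topspace_eq_carrier by auto
  next
    fix x assume "x \<in> {x \<in> topspace T. inv g \<otimes> x \<in> U}"
    moreover from this have "x = g \<otimes> (inv g \<otimes> x)" using g topspace_eq_carrier by (simp add: m_assoc[symmetric])
    ultimately show "x \<in> (\<lambda>x. g \<otimes> x) ` U" by blast
  qed
  then show ?thesis
    using openin_continuous_map_preimage[OF continuous_map_left_translation[OF inv_closed[OF g]] U] by simp
qed

lemma locally_compact_if_compact_neighbourhood: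
  assumes U: "openin T U" "x \<in> U" and K: "compactin T K" "U \<subseteq> K"
  shows "locally_compact_space T"
  unfolding locally_compact_space_def
proof
  fix y assume y: "y \<in> topspace T"
  have xy: "x \<in> carrier G" "y \<in> carrier G" using U openin_subset y topspace_eq_carrier by auto
  define g where "g = y \<otimes> inv x"
  have g: "g \<in> carrier G" "y = g \<otimes> x" using xy by (auto simp: g_def m_assoc)
  have "openin T ((\<lambda>x. g \<otimes> x) ` U)" using openin_left_translation[OF g(1) U(1)] .
  moreover have "compactin T ((\<lambda>x. g \<otimes> x) ` K)"
    using image_compactin[OF K(1) continuous_map_left_translation[OF g(1)]] .
  ultimately show "\<exists>U K. openin T U \<and> compactin T K \<and> y \<in> U \<and> U \<subseteq> K"
    using g(2) U(2) K(2) by blast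
qed

lemma continuous_map_left_quotient: "continuous_map (prod_topology T T) T (\<lambda>(x, y). inv x \<otimes> y)"
proof -
  have "continuous_map (prod_topology T T) T (\<lambda>p. inv (fst p))"
    using continuous_map_compose[OF continuous_map_fst continuous_inv] by (simp add: o_def)
  then have "continuous_map (prod_topology T T) (prod_topology T T) (\<lambda>p. (inv (fst p), snd p))"
    by (simp add: continuous_map_paired continuous_map_snd)
  from continuous_map_compose[OF this continuous_mult] show ?thesis by (simp add: o_def case_prod_unfold)
qed

lemma left_quotient_neighbourhood:
  assumes z: "z \<in> carrier G" and U: "openin T U" "\<one> \<in> U"
  obtains N where "openin T N" "z \<in> N" "\<And>a b. a \<in> N \<Longrightarrow> b \<in> N \<Longrightarrow> inv a \<otimes> b \<in> U"
proof -
  have "openin (prod_topology T T) {p \<in> topspace (prod_topology T T). (\<lambda>(x, y). inv x \<otimes> y) p \<in> U}"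
    using openin_continuous_map_preimage[OF continuous_map_left_quotient U(1)] .
  moreover have "(z, z) \<in> {p \<in> topspace (prod_topology T T). (\<lambda>(x, y). inv x \<otimes> y) p \<in> U}"
    using z U(2) topspace_eq_carrier by simp
  ultimately obtain A B where AB: "openin T A" "openin T B" "z \<in> A" "z \<in> B"
    "A \<times> B \<subseteq> {p \<in> topspace (prod_topology T T). (\<lambda>(x, y). inv x \<otimes> y) p \<in> U}"
    unfolding openin_prod_topology_alt by meson
  show thesis
  proof (rule that[of "A \<inter> B"])
    fix a b assume "a \<in> A \<inter> B" "b \<in> A \<inter> B"
    then have "(a, b) \<in> A \<times> B" by blast
    from subsetD[OF AB(5) this] show "inv a \<otimes> b \<in> U" by simp
  qed (use AB in auto)
qed

lemma openin_inverse:
  assumes "openin T U"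
  shows "openin T {x \<in> carrier G. inv x \<in> U}"
  using openin_continuous_map_preimage[OF continuous_inv assms] topspace_eq_carrier by simp

text \<open>
  In a group the \<pi>-character equals the character: if \<open>U\<close> ranges over a local \<pi>-base at any point, the
  symmetric sets of all \<open>inv u \<otimes> x\<close> with \<open>u, x \<in> U\<close> form a base at \<open>\<one>\<close>.
\<close>

lemma countable_base_at_one_if_countable_local_pi_base:
  assumes z: "z \<in> carrier G" and base: "countable \<U>" "local_pi_base T z \<U>"
  obtains \<B> where "countable \<B>"
    "\<And>B. B \<in> \<B> \<Longrightarrow> openin T B \<and> \<one> \<in> B \<and> (\<forall>x\<in>B. inv x \<in> B)"
    "\<And>V. openin T V \<Longrightarrow> \<one> \<in> V \<Longrightarrow> \<exists>B\<in>\<B>. B \<subseteq> V"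
proof -
  define q where "q U = (\<Union>u\<in>U. (\<lambda>x. inv u \<otimes> x) ` U)" for U
  have U: "openin T U" "U \<noteq> {}" "U \<subseteq> carrier G" if "U \<in> \<U>" for U
    using base(2) that openin_subset[of T U] topspace_eq_carrier unfolding local_pi_base_def by auto
  show thesis
  proof (rule that[of "q ` \<U>"])
    show "countable (q ` \<U>)" using base(1) by simp
  next
    fix B assume "B \<in> q ` \<U>"
    then obtain U0 where U0: "U0 \<in> \<U>" "B = q U0" by blast
    note U1 = U[OF U0(1)]
    obtain u where u: "u \<in> U0" using U1(2) by blast
    have "openin T B"
      unfolding U0(2) q_def by (intro openin_Union) (use U1 openin_left_translation in auto)
    moreover have "\<one> \<in> B" unfolding U0(2) q_def using u U1(3)
      by (intro UN_I[OF u] image_eqI[OF _ u]) auto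
    moreover have "inv x \<in> B" if x: "x \<in> B" for x
    proof -
      obtain v w where vw: "v \<in> U0" "w \<in> U0" "x = inv v \<otimes> w" using x unfolding U0(2) q_def by blast
      then have "inv x = inv w \<otimes> v" using U1(3) by (simp add: inv_mult_group subset_iff)
      then show ?thesis unfolding U0(2) q_def using vw by blast
    qed
    ultimately show "openin T B \<and> \<one> \<in> B \<and> (\<forall>x\<in>B. inv x \<in> B)" by blast
  next
    fix V assume V: "openin T V" "\<one> \<in> V"
    obtain N where N: "openin T N" "z \<in> N" "\<And>a b. a \<in> N \<Longrightarrow> b \<in> N \<Longrightarrow> inv a \<otimes> b \<in> V"
      using left_quotient_neighbourhood[OF z V] by metis
    then obtain U0 where U0: "U0 \<in> \<U>" "U0 \<subseteq> N" using base(2) unfolding local_pi_base_def by blast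
    then have "q U0 \<subseteq> V" unfolding q_def using N(3) by blast
    then show "\<exists>B\<in>q ` \<U>. B \<subseteq> V" using U0(1) by blast
  qed
qed

text \<open>
  If \<open>x\<close> lies in the translate \<open>d B\<close>, then \<open>d B\<close> is contained in \<open>x B\<inverse> B\<close>, which is small when \<open>B\<close> is. So the
  translates in the given countable covers form a base.
\<close>

lemma second_countable_if_countably_many_translates:
  assumes base: "countable \<B>"
    "\<And>B. B \<in> \<B> \<Longrightarrow> openin T B"
    "\<And>V. openin T V \<Longrightarrow> \<one> \<in> V \<Longrightarrow> \<exists>B\<in>\<B>. B \<subseteq> V"
    and narrow: "\<And>B. B \<in> \<B> \<Longrightarrow> \<exists>D. countable D \<and> D \<subseteq> carrier G \<and> carrier G \<subseteq> (\<Union>d\<in>D. (\<lambda>x. d \<otimes> x) ` B)"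
  shows "second_countable T"
proof -
  obtain D where D: "\<And>B. B \<in> \<B> \<Longrightarrow> countable (D B)" "\<And>B. B \<in> \<B> \<Longrightarrow> D B \<subseteq> carrier G"
    "\<And>B. B \<in> \<B> \<Longrightarrow> carrier G \<subseteq> (\<Union>d\<in>D B. (\<lambda>x. d \<otimes> x) ` B)" using narrow by metis
  let ?C = "\<Union>B\<in>\<B>. (\<lambda>d. (\<lambda>x. d \<otimes> x) ` B) ` D B"
  show ?thesis unfolding second_countable_def
  proof (intro exI[of _ ?C] conjI ballI allI impI)
    show "countable ?C" using base(1) D(1) by (intro countable_UN countable_image)
    fix V assume "V \<in> ?C"
    then show "openin T V" using base(2) D(2) openin_left_translation by blast
  next
    fix V x assume Vx: "openin T V \<and> x \<in> V"
    then have x: "x \<in> carrier G" using openin_subset topspace_eq_carrier by auto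
    let ?V = "(\<lambda>y. inv x \<otimes> y) ` V"
    have "openin T ?V" using openin_left_translation x Vx by simp
    moreover have "\<one> \<in> ?V" using Vx x by (intro image_eqI[of _ _ x]) auto
    ultimately obtain N where N: "openin T N" "\<one> \<in> N" "\<And>a b. a \<in> N \<Longrightarrow> b \<in> N \<Longrightarrow> inv a \<otimes> b \<in> ?V"
      using left_quotient_neighbourhood[OF one_closed] by metis
    then obtain B where B: "B \<in> \<B>" "B \<subseteq> N" using base(3) by blast
    then have Bc: "B \<subseteq> carrier G" using base(2) openin_subset topspace_eq_carrier by metis
    obtain d b where d: "d \<in> D B" "b \<in> B" "x = d \<otimes> b" using D(3)[OF B(1)] x by blast
    have dc: "d \<in> carrier G" "b \<in> carrier G" using d D(2)[OF B(1)] Bc by auto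
    have "d \<otimes> c \<in> V" if c: "c \<in> B" for c
    proof -
      have cc: "c \<in> carrier G" using c Bc by auto
      have "inv b \<otimes> c \<in> ?V" using N(3) B(2) d(2) c by blast
      then obtain v where v: "v \<in> V" "inv b \<otimes> c = inv x \<otimes> v" by blast
      have vc: "v \<in> carrier G" using v Vx openin_subset topspace_eq_carrier by auto
      have "inv x \<otimes> v = inv b \<otimes> (inv d \<otimes> v)" unfolding d(3) using dc vc by (simp add: inv_mult_group m_assoc)
      then have "c = inv d \<otimes> v" using v(2) dc cc vc by simp
      then have "d \<otimes> c = v" using dc vc by (simp add: m_assoc[symmetric])
      then show ?thesis using v by simp
    qed
    then show "\<exists>W\<in>?C. x \<in> W \<and> W \<subseteq> V" using B(1) d by blast
  qed
qed

text \<open>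
  For a maximal set \<open>D\<close> without distinct \<open>d, d'\<close> such that \<open>inv d \<otimes> d' \<in> B\<close>, the translates of \<open>B\<close> by \<open>D\<close> cover the
  group, so \<open>D\<close> is uncountable. If \<open>V\<close> is so small that \<open>V V\<inverse> V V\<inverse> \<subseteq> B\<close> then every translate of \<open>V\<close> meets at most
  one of the sets \<open>d V\<close>, in other words, these form a discrete family.
\<close>

lemma uncountable_separated_set_if_not_narrow:
  assumes B: "openin T B" "\<one> \<in> B" "\<forall>x\<in>B. inv x \<in> B"
    and wide: "\<nexists>D. countable D \<and> D \<subseteq> carrier G \<and> carrier G \<subseteq> (\<Union>d\<in>D. (\<lambda>x. d \<otimes> x) ` B)"
  obtains D V where "uncountable D" "D \<subseteq> carrier G" "openin T V" "\<one> \<in> V"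
    "\<And>g d d'. \<lbrakk>g \<in> carrier G; d \<in> D; d' \<in> D; d \<noteq> d'; (\<lambda>x. g \<otimes> x) ` V \<inter> (\<lambda>x. d \<otimes> x) ` V \<noteq> {}\<rbrakk>
        \<Longrightarrow> (\<lambda>x. g \<otimes> x) ` V \<inter> (\<lambda>x. d' \<otimes> x) ` V = {}"
proof -
  let ?F = "{D. D \<subseteq> carrier G \<and> (\<forall>d\<in>D. \<forall>d'\<in>D. d \<noteq> d' \<longrightarrow> inv d \<otimes> d' \<notin> B)}"
  have "\<exists>M\<in>?F. \<forall>X\<in>?F. M \<subseteq> X \<longrightarrow> X = M"
  proof (rule subset_Zorn')
    fix C assume C: "subset.chain ?F C"
    then have sub: "C \<subseteq> ?F" "\<And>X Y. X \<in> C \<Longrightarrow> Y \<in> C \<Longrightarrow> X \<subseteq> Y \<or> Y \<subseteq> X"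
      unfolding subset_chain_def by auto
    show "\<Union>C \<in> ?F"
    proof (intro CollectI conjI ballI impI)
      show "\<Union>C \<subseteq> carrier G" using sub(1) by blast
      fix d d' assume dd: "d \<in> \<Union>C" "d' \<in> \<Union>C" "d \<noteq> d'"
      then obtain X Y where XY: "X \<in> C" "d \<in> X" "Y \<in> C" "d' \<in> Y" by blast
      obtain Z where "Z \<in> C" "d \<in> Z" "d' \<in> Z" using sub(2)[OF XY(1,3)] XY by (metis subsetD)
      then show "inv d \<otimes> d' \<notin> B" using subsetD[OF sub(1) \<open>Z \<in> C\<close>] dd(3) by auto
    qed
  qed
  then obtain D where DF: "D \<in> ?F" and maxD: "\<forall>X\<in>?F. D \<subseteq> X \<longrightarrow> X = D" by (rule bexE)
  have max: "X = D" if "X \<in> ?F" "D \<subseteq> X" for X using bspec[OF maxD that(1)] that(2) by (rule mp)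
  have D: "D \<subseteq> carrier G" "\<And>d d'. d \<in> D \<Longrightarrow> d' \<in> D \<Longrightarrow> d \<noteq> d' \<Longrightarrow> inv d \<otimes> d' \<notin> B"
    using DF by simp_all
  have "carrier G \<subseteq> (\<Union>d\<in>D. (\<lambda>x. d \<otimes> x) ` B)"
  proof
    fix g assume g: "g \<in> carrier G"
    have "\<exists>d\<in>D. inv d \<otimes> g \<in> B"
    proof (cases "g \<in> D")
      case True then show ?thesis using B(2) g by (intro bexI[of _ g]) auto
    next
      case False
      then have "insert g D \<notin> ?F" using max[of "insert g D"] by blast
      then obtain d where d: "d \<in> D" "inv d \<otimes> g \<in> B \<or> inv g \<otimes> d \<in> B" using D g by blast
      have "inv (inv g \<otimes> d) = inv d \<otimes> g" using d D g by (simp add: inv_mult_group subset_iff)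
      then show ?thesis using d B(3) by metis
    qed
    then obtain d where d: "d \<in> D" "inv d \<otimes> g \<in> B" by blast
    have "g = d \<otimes> (inv d \<otimes> g)" using d D g by (simp add: m_assoc[symmetric] subset_iff)
    then show "g \<in> (\<Union>d\<in>D. (\<lambda>x. d \<otimes> x) ` B)" using d by blast
  qed
  then have unc: "uncountable D" using wide D(1) by blast
  obtain N where N: "openin T N" "\<one> \<in> N" "\<And>a b. a \<in> N \<Longrightarrow> b \<in> N \<Longrightarrow> inv a \<otimes> b \<in> B"
    using left_quotient_neighbourhood[OF one_closed B(1,2)] by metis
  obtain M where M: "openin T M" "\<one> \<in> M" "\<And>a b. a \<in> M \<Longrightarrow> b \<in> M \<Longrightarrow> inv a \<otimes> b \<in> N"
    using left_quotient_neighbourhood[OF one_closed N(1,2)] by metis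
  define V where "V = {x \<in> carrier G. inv x \<in> M}"
  have V: "openin T V" "\<one> \<in> V" unfolding V_def using openin_inverse[OF M(1)] M(2) by auto
  have VN: "v \<otimes> inv w \<in> N" if "v \<in> V" "w \<in> V" for v w
    using M(3)[of "inv v" "inv w"] that unfolding V_def by simp
  show thesis
  proof (rule that[OF unc D(1) V])
    fix g d d' assume g: "g \<in> carrier G" and dd: "d \<in> D" "d' \<in> D" "d \<noteq> d'"
      and "(\<lambda>x. g \<otimes> x) ` V \<inter> (\<lambda>x. d \<otimes> x) ` V \<noteq> {}"
    then obtain v w where vw: "v \<in> V" "w \<in> V" "g \<otimes> v = d \<otimes> w" by blast
    show "(\<lambda>x. g \<otimes> x) ` V \<inter> (\<lambda>x. d' \<otimes> x) ` V = {}"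
    proof (rule ccontr)
      assume "\<not> ?thesis"
      then obtain v' w' where vw': "v' \<in> V" "w' \<in> V" "g \<otimes> v' = d' \<otimes> w'" by blast
      have cc: "v \<in> carrier G" "w \<in> carrier G" "v' \<in> carrier G" "w' \<in> carrier G"
        "d \<in> carrier G" "d' \<in> carrier G" using vw vw' dd D(1) unfolding V_def by auto
      have "d = g \<otimes> (v \<otimes> inv w)" "d' = g \<otimes> (v' \<otimes> inv w')"
        using vw(3) vw'(3) cc g by (metis inv_solve_right m_assoc m_closed inv_closed)+
      moreover have "inv (g \<otimes> p) \<otimes> (g \<otimes> q) = inv p \<otimes> q" if "p \<in> carrier G" "q \<in> carrier G" for p q
      proof -
        have "inv g \<otimes> (g \<otimes> q) = q" using that g by (simp add: m_assoc[symmetric])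
        then show ?thesis using that g by (simp add: inv_mult_group m_assoc)
      qed
      ultimately have "inv d \<otimes> d' = inv (v \<otimes> inv w) \<otimes> (v' \<otimes> inv w')" using cc by simp
      then show False using N(3)[OF VN[OF vw(1,2)] VN[OF vw'(1,2)]] D(2)[OF dd] by simp
    qed
  qed
qed

end

section \<open>Remainders of topological groups\<close>

text \<open>
  A non-empty open set of the compactification that misses the remainder would provide a compact
  neighbourhood in the group, which translations carry to every point.
\<close>

lemma (in topological_group) dense_remainder:
  assumes nlc: "\<not> locally_compact_space T" and comp: "Hausdorff_compactification T X"
  shows "X closure_of (topspace X - topspace T) = topspace X"
  unfolding dense_intersects_open
proof (intro allI impI, rule ccontr)
  fix W assume W: "openin X W \<and> W \<noteq> {}" and "\<not> (topspace X - topspace T) \<inter> W \<noteq> {}"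
  then have sub: "W \<subseteq> topspace T" using openin_subset by blast
  have X: "compact_space X" "Hausdorff_space X" and T: "subtopology X (topspace T) = T"
    using comp unfolding Hausdorff_compactification_def by auto
  obtain x where x: "x \<in> W" using W by blast
  obtain U where U: "openin X U" "x \<in> U" "X closure_of U \<subseteq> W"
    using regular_space_closure_neighbourhood[OF compact_Hausdorff_imp_regular_space[OF X], of W x] W x by blast
  have UW: "U \<subseteq> X closure_of U" using U(1) by (simp add: closure_of_subset openin_subset)
  have "compactin X (X closure_of U)" using X(1) by (simp add: closedin_compact_space)
  then have "compactin T (X closure_of U)"
    using U(3) sub compactin_subtopology[of X "topspace T" "X closure_of U"] T by auto
  moreover have "openin T U"
    using openin_subtopology_Int[OF U(1), of "topspace T"] UW U(3) sub T by (simp add: Int_absorb2)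
  ultimately have "locally_compact_space T" using U(2) UW by (intro locally_compact_if_compact_neighbourhood)
  then show False using nlc by contradiction
qed

text \<open>
  Otherwise there is a discrete family of translates \<open>d V\<close> for uncountably many \<open>d\<close>. Open extensions \<open>W d\<close> of these sets are
  pairwise disjoint, because the group is dense. Each \<open>W d\<close> contains a point \<open>y d\<close> of the remainder. Since the family
  is discrete in the group, no point of the group is in the closure \<open>K\<close> of the set of all \<open>y d\<close>. So \<open>K\<close> is a compact
  subset of the remainder, hence hereditarily separable, but it contains the uncountable discrete set of the points \<open>y d\<close>.
\<close>

lemma (in topological_group) countably_many_translates_cover:
  assumes comp: "Hausdorff_compactification T X"
    and dense: "X closure_of (topspace X - topspace T) = topspace X"
    and loc: "has_locally has_point_countable_p_metabase (subtopology X (topspace X - topspace T))"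
    and B: "openin T B" "\<one> \<in> B" "\<forall>x\<in>B. inv x \<in> B"
  shows "\<exists>D. countable D \<and> D \<subseteq> carrier G \<and> carrier G \<subseteq> (\<Union>d\<in>D. (\<lambda>x. d \<otimes> x) ` B)"
proof (rule ccontr)
  assume "\<not> ?thesis"
  then obtain D V where D: "uncountable D" "D \<subseteq> carrier G" and V: "openin T V" "\<one> \<in> V"
    and sep: "\<And>g d d'. \<lbrakk>g \<in> carrier G; d \<in> D; d' \<in> D; d \<noteq> d'; (\<lambda>x. g \<otimes> x) ` V \<inter> (\<lambda>x. d \<otimes> x) ` V \<noteq> {}\<rbrakk>
        \<Longrightarrow> (\<lambda>x. g \<otimes> x) ` V \<inter> (\<lambda>x. d' \<otimes> x) ` V = {}"
    using uncountable_separated_set_if_not_narrow[OF B] by metis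
  have X: "compact_space X" "Hausdorff_space X" and T: "subtopology X (topspace T) = T"
    and dT: "X closure_of topspace T = topspace X"
    using comp unfolding Hausdorff_compactification_def by auto
  define Z where "Z = topspace X - topspace T"
  have "\<forall>g\<in>carrier G. \<exists>W. openin X W \<and> (\<lambda>x. g \<otimes> x) ` V = W \<inter> topspace T"
    using openin_left_translation[OF _ V(1)] T by (metis openin_subtopology)
  from bchoice[OF this] obtain W where "\<forall>g\<in>carrier G. openin X (W g) \<and> (\<lambda>x. g \<otimes> x) ` V = W g \<inter> topspace T"
    by blast
  then have W: "\<And>g. g \<in> carrier G \<Longrightarrow> openin X (W g)"
    "\<And>g. g \<in> carrier G \<Longrightarrow> (\<lambda>x. g \<otimes> x) ` V = W g \<inter> topspace T" by auto
  have gW: "g \<in> W g" if g: "g \<in> carrier G" for g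
  proof -
    have "g \<otimes> \<one> \<in> (\<lambda>x. g \<otimes> x) ` V" using V(2) by (rule imageI)
    then show ?thesis using W(2)[OF g] g by simp
  qed
  have meet: "(\<lambda>x. g \<otimes> x) ` V \<inter> (\<lambda>x. d \<otimes> x) ` V \<noteq> {}"
    if "g \<in> carrier G" "d \<in> carrier G" "W g \<inter> W d \<noteq> {}" for g d
  proof -
    have "openin X (W g \<inter> W d)" using W(1) that by auto
    then have "topspace T \<inter> (W g \<inter> W d) \<noteq> {}" using dT that(3) unfolding dense_intersects_open by metis
    then show ?thesis unfolding W(2)[OF that(1)] W(2)[OF that(2)] by blast
  qed
  have Wdisj: "d = d'" if "d \<in> D" "d' \<in> D" "W d \<inter> W d' \<noteq> {}" for d d'
  proof (rule ccontr)
    assume "d \<noteq> d'"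
    have c: "d \<in> carrier G" "d' \<in> carrier G" using that D by auto
    have "(\<lambda>x. d \<otimes> x) ` V \<inter> (\<lambda>x. d \<otimes> x) ` V \<noteq> {}" using V(2) by blast
    then have "(\<lambda>x. d \<otimes> x) ` V \<inter> (\<lambda>x. d' \<otimes> x) ` V = {}" using sep[OF c(1) that(1,2) \<open>d \<noteq> d'\<close>] by metis
    then show False using meet[OF c that(3)] by contradiction
  qed
  have "\<forall>d\<in>D. \<exists>y. y \<in> W d \<inter> Z"
  proof
    fix d assume "d \<in> D"
    then have "openin X (W d)" "W d \<noteq> {}" using W(1) gW D(2) by auto
    then show "\<exists>y. y \<in> W d \<inter> Z" using dense unfolding dense_intersects_open Z_def[symmetric] by blast
  qed
  from bchoice[OF this] obtain y where y: "\<And>d. d \<in> D \<Longrightarrow> y d \<in> W d" "\<And>d. d \<in> D \<Longrightarrow> y d \<in> Z" by blast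
  define K where "K = X closure_of (y ` D)"
  have yK: "y ` D \<subseteq> K" unfolding K_def using y(2) by (intro closure_of_subset) (auto simp: Z_def)
  have KZ: "K \<subseteq> Z"
  proof (rule subsetI, rule ccontr)
    fix g assume gK: "g \<in> K" "g \<notin> Z"
    then have gT: "g \<in> topspace T" unfolding Z_def K_def using closure_of_subset_topspace[of X] by blast
    then have g: "g \<in> carrier G" using topspace_eq_carrier by simp
    have near: "\<exists>d\<in>D. y d \<in> U" if "openin X U" "g \<in> U" for U
      using gK(1) that unfolding K_def in_closure_of by auto
    obtain d where d: "d \<in> D" "y d \<in> W g" using near[OF W(1)[OF g] gW[OF g]] by (rule bexE)
    have "openin X (W g - {y d})"
      using W(1)[OF g] X(2) y(2)[OF d(1)] by (intro openin_diff closedin_Hausdorff_singleton) (auto simp: Z_def)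
    moreover have "g \<in> W g - {y d}" using gW[OF g] y(2)[OF d(1)] gT unfolding Z_def by auto
    ultimately have "\<exists>d'\<in>D. y d' \<in> W g - {y d}" by (rule near)
    then obtain d' where d': "d' \<in> D" "y d' \<in> W g - {y d}" by (rule bexE)
    then have ne: "d \<noteq> d'" by auto
    have c: "d \<in> carrier G" "d' \<in> carrier G" using d d' D(2) by auto
    have "W g \<inter> W d \<noteq> {}" "W g \<inter> W d' \<noteq> {}" using d(2) d'(2) y(1)[OF d(1)] y(1)[OF d'(1)] by auto
    then show False using sep[OF g d(1) d'(1) ne] meet[OF g c(1)] meet[OF g c(2)] by metis
  qed
  have K: "closedin X K" "K \<subseteq> topspace X" unfolding K_def by (auto simp: closure_of_subset_topspace)
  have "has_locally has_point_countable_p_metabase (subtopology X K)"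
    using has_locally_point_countable_p_metabase_subset loc KZ unfolding Z_def by blast
  moreover have "compact_space (subtopology X K)"
    using closedin_compact_space[OF X(1) K(1)] by (simp add: compact_space_subtopology)
  then have "Lindelof_space (subtopology X K)" by (rule compact_imp_Lindelof_space)
  ultimately obtain \<A> where A: "p_metabase (subtopology X K) \<A>" "point_countable (subtopology X K) \<A>"
    using Lindelof_has_point_countable_p_metabase_if_locally
    unfolding has_point_countable_p_metabase_def by blast
  have "Sigma_family X K {}"
    using K closure_of_minimal[of _ K X] by (intro Sigma_family_empty) auto
  from hereditarily_separable_if_point_countable_p_metabase[OF X(1) this A yK]
  obtain C where C: "countable C" "C \<subseteq> y ` D" "y ` D \<subseteq> X closure_of C" by metis
  have "y d \<in> C" if d: "d \<in> D" for d
  proof -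
    have "y d \<in> X closure_of C" "openin X (W d)" using C(3) d W(1) D(2) by auto
    then obtain c where c: "c \<in> C" "c \<in> W d" using y(1)[OF d] unfolding in_closure_of by blast
    then obtain d' where d': "d' \<in> D" "c = y d'" using C(2) by blast
    then have "d = d'" using Wdisj[OF d d'(1)] y(1)[OF d'(1)] c(2) by blast
    then show ?thesis using c(1) d'(2) by simp
  qed
  then have "countable (y ` D)" using countable_subset[OF _ C(1)] by blast
  moreover have "inj_on y D"
  proof (rule inj_onI)
    fix d d' assume "d \<in> D" "d' \<in> D" "y d = y d'"
    then show "d = d'" using Wdisj[of d d'] y(1)[of d] y(1)[of d'] by auto
  qed
  ultimately show False using D(1) countable_image_inj_on by blast
qed

theorem theorem2p5:
  fixes G :: "('a, 'b) monoid_scheme" and T bG Y :: "'a topology"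
  assumes "topological_group G T"
    and "\<not> locally_compact_space T"
    and "Hausdorff_compactification T bG"
    and "Y = subtopology bG (topspace bG - topspace T)"
    and "has_locally has_point_countable_p_metabase Y"
    and "pi_character Y \<le>o natLeq"
  shows "separable_space T \<and> metrizable_space T \<and> separable_space bG \<and> metrizable_space bG"
proof -
  interpret topological_group G T by fact
  define Z where "Z = topspace bG - topspace T"
  have Y: "Y = subtopology bG Z" "topspace Y = Z" using assms(4) by (auto simp: Z_def)
  have X: "compact_space bG" "Hausdorff_space bG" and T: "subtopology bG (topspace T) = T"
    "topspace T \<subseteq> topspace bG" and dT: "bG closure_of topspace T = topspace bG"
    using assms(3) unfolding Hausdorff_compactification_def by auto
  have reg: "regular_space bG" using compact_Hausdorff_imp_regular_space X by blast
  have dZ: "bG closure_of Z = topspace bG" unfolding Z_def using assms(2,3) by (rule dense_remainder)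
  have loc: "has_locally has_point_countable_p_metabase (subtopology bG Z)" using assms(5) Y(1) by simp
  have "\<not> openin bG Z"
  proof
    assume "openin bG Z"
    then have "closedin bG (topspace bG - Z)" by (simp add: closedin_diff)
    moreover have "topspace bG - Z = topspace T" using T(2) unfolding Z_def by blast
    ultimately have "compactin bG (topspace T)" using X(1) by (simp add: closedin_compact_space)
    then have "compact_space T" using T(1) by (metis compact_space_subtopology)
    then show False using assms(2) compact_imp_locally_compact_space by blast
  qed
  then obtain D where D: "D \<subseteq> Z" "countable D" "\<not> bG closure_of D \<subseteq> Z"
    using openin_if_closed_under_countable_closures[OF X _ dZ loc] unfolding Z_def by blast
  then obtain z where z: "z \<in> bG closure_of D" "z \<in> topspace T"
    using closure_of_subset_topspace[of bG D] unfolding Z_def by blast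
  have "\<exists>\<U>. countable \<U> \<and> local_pi_base bG y \<U>" if "y \<in> D" for y
  proof -
    have y: "y \<in> Z" using that D(1) by blast
    then obtain \<U> where "countable \<U>" "local_pi_base (subtopology bG Z) y \<U>"
      using assms(6) Y unfolding pi_character_countable_iff by auto
    then show ?thesis by (rule local_pi_base_dense_superspace[OF reg dZ y])
  qed
  then obtain \<W> where W: "countable \<W>" "local_pi_base bG z \<W>"
    using local_pi_base_closure_point[OF D(2) _ z(1)] by blast
  have "countable ((\<lambda>W. W \<inter> topspace T) ` \<W>)" "local_pi_base T z ((\<lambda>W. W \<inter> topspace T) ` \<W>)"
    using W(1) local_pi_base_dense_subspace[OF dT W(2)] T(1) by simp_all
  then obtain \<B> where B: "countable \<B>"
    "\<And>B. B \<in> \<B> \<Longrightarrow> openin T B \<and> \<one>\<^bsub>G\<^esub> \<in> B \<and> (\<forall>x\<in>B. inv\<^bsub>G\<^esub> x \<in> B)"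
    "\<And>V. openin T V \<Longrightarrow> \<one>\<^bsub>G\<^esub> \<in> V \<Longrightarrow> \<exists>B\<in>\<B>. B \<subseteq> V"
    using countable_base_at_one_if_countable_local_pi_base[of z] z(2) topspace_eq_carrier by metis
  have sc: "second_countable T"
  proof (rule second_countable_if_countably_many_translates[OF B(1) _ B(3)])
    fix B assume "B \<in> \<B>"
    show "openin T B" using B(2)[OF \<open>B \<in> \<B>\<close>] by simp
    from B(2)[OF \<open>B \<in> \<B>\<close>] show "\<exists>D. countable D \<and> D \<subseteq> carrier G \<and> carrier G \<subseteq> (\<Union>d\<in>D. (\<lambda>x. d \<otimes>\<^bsub>G\<^esub> x) ` B)"
      using countably_many_translates_cover[OF assms(3) dZ[unfolded Z_def] loc[unfolded Z_def], of B] by metis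
  qed
  have met: "metrizable_space bG"
    using metrizable_if_second_countable_dense_subspace[OF X dT T(2)] sc T(1) loc unfolding Z_def by simp
  moreover have "metrizable_space T" using metrizable_space_subtopology[OF met, of "topspace T"] T(1) by simp
  moreover have sep: "separable_space T" using sc by (rule second_countable_imp_separable_space)
  moreover have "separable_space bG"
  proof -
    obtain C where C: "countable C" "C \<subseteq> topspace T" "T closure_of C = topspace T"
      using sep unfolding separable_space_def by blast
    have "topspace T \<subseteq> bG closure_of C" using C(3) T(1) closure_of_subtopology_subset[of bG "topspace T" C] by simp
    then have "bG closure_of topspace T \<subseteq> bG closure_of C" using closure_of_minimal closedin_closure_of by metis
    then have "bG closure_of C = topspace bG" using dT closure_of_subset_topspace[of bG C] by simp
    then show ?thesis unfolding separable_space_def using C(1,2) T(2) by blast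
  qed
  ultimately show ?thesis by simp
qed

end
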